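(* In the scheduling setting described in the context, consider the continuous-time constraints (C) on functions $x_{ij}(\cdot), s_{ijk}(\cdot), a_{ijk}(\cdot)$ ($i\in I$, $j\in J_i$, $k\in K$): \begin{align*} & x_{ij}((j-1)p_i)=\underline{x}_i, && \forall i,j\\ & x_{ij}((j-1)p_i+d_i)=0, && \forall i,j\\ & \dot{x}_{ij}(t)=-\sum_{k}s_{ijk}(t)a_{ijk}(t), && \forall i,j,\ \text{a.e. } t\in[0,L]\\ & \sum_k a_{ijk}(t)\le 1, && \forall i,j,\ t\in[0,L]\\ & \sum_{i,j}a_{ijk}(t)\le 1, && \forall k,\ t\in[0,L]\\ & s_{min}\le s_{ijk}(t)\le 1, && \forall i,j,k,\ t\in[0,L]\\ & a_{ijk}(t)\in\{0,1\}, && \forall i,j,k,\ t\in[0,L], \end{align*} and the finite-dimensional nonlinear program (P) in the variables $x_{ij}[\cdot]$, $s_{ij}[\cdot]$, $a_{ij}[\cdot]$: \begin{align*} \text{minimize}\quad & \sum_{\mu,i,j}(\tau_{\mu+1}-\tau_\mu)\,\ell(a_{ij}[\mu],s_{ij}[\mu])\\ \text{subject to}\quad & x_{ij}[\Phi_A(T_{ij})]=\underline{x}_i, && \forall i,j\\ & x_{ij}[\Phi_D(T_{ij})]=0, && \forall i,j\\ & x_{ij}[\mu+1]=x_{ij}[\mu]-(\tau_{\mu+1}-\tau_\mu)s_{ij}[\mu]a_{ij}[\mu], && \forall i,j,\mu\\ & \sum_{i,j}a_{ij}[\mu]\le m, && \forall \mu\\ & s_{min}\le s_{ij}[\mu]\le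 1, && \forall i,j,\mu\\ & 0\le a_{ij}[\mu]\le 1, && \forall i,j,\mu. \end{align*} If a solution exists to (C), then a solution to (P) exists. Furthermore, at least one valid schedule satisfying (C) can be constructed from a solution to (P) with the same energy consumption, i.e. with $$\sum_{i,j,k}\int_0^L \ell(a_{ijk}(t),s_{ijk}(t))\,dt=\sum_{\mu,i,j}(\tau_{\mu+1}-\tau_\mu)\,\ell(a_{ij}[\mu],s_{ij}[\mu]).$$
   Context: There are $n$ periodic real-time tasks $T_i=(c_i,d_i,p_i)$, $i\in I=\{1,\dots,n\}$, where $c_i$ is the required number of processor cycles, $d_i$ the deadline and $p_i$ the period (the deadline may be less than, equal to, or greater than the period), and $m$ identical processors $k\in K=\{1,\dots,m\}$ with maximum frequency $f_{max}$. All tasks start at the same time $0$, can be pre-empted at any time, may migrate between processors, do not share resources and have no precedence constraints. The hyperperiod $L$ is the least common multiple of all task periods, and $J_i=\{1,\dots,L/p_i\}$. Job $T_{ij}$ ($j\in J_i$) is the $j$-th instance of $T_i$; it arrives at time $(j-1)p_i$ and has its deadline at time $(j-1)p_i+d_i$. The minimum execution time is $\underline{x}_i=c_i/f_{max}$. It is a standing assumption that $D:=\sum_{i=1}^n \underline{x}_i/\min\{d_i,p_i\}\le m$. The speed of a processor is its operating frequency divided by $f_{max}$, and $s_{min}$ is the minimum execution speed. In (C), $x_{ij}(t)$ is the remaining minimum execution time of job $T_{ij}$ at time $t$, $s_{ijk}(t)$ is its execution speed on processor $k$, and $a_{ijk}(t)=1$ if and only if the job is active on processor $k$ at time $t$.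 Cost: $\ell(a,s)=a\,(P_{active}(s)-P_{idle})$, where $P_{active}(s)=\alpha s^\beta+P_s$ with constants $\alpha>0$, $\beta\ge1$, $P_s>0$, $P_{idle}>0$, and $P_{active}(s)-P_{idle}>0$. Major grid: $\{\tau_0,\dots,\tau_N\}$ is the set of time instances corresponding to the distinct arrival times and deadlines of all jobs within the hyperperiod $L$, with $0=\tau_0\le\tau_1\le\dots\le\tau_N=L$. In (P), $x_{ij}[\mu]$ stands for $x_{ij}(\tau_\mu)$, and $a_{ij}[\mu]\in\mathbb{R}$ is the fraction of the interval $[\tau_\mu,\tau_{\mu+1})$ for which job $T_{ij}$ executes on a processor at speed $s_{ij}[\mu]$. $\Phi_A(T_{ij})$ is the index $\mu$ with $\tau_\mu=(j-1)p_i$, and $\Phi_D(T_{ij})$ is the index $\mu$ with $\tau_\mu=(j-1)p_i+d_i$. The quantifiers $\forall i,j,k,\mu$ range over $i\in I$, $j\in J_i$, $k\in K$, $\mu\in\{0,\dots,N-1\}$. *)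

theory Defs
  imports "HOL-Analysis.Analysis"
begin

(* Tasks, processors and jobs are numbered from 1. All quantities other than the
   two counts are real; in particular periods need not be integers. *)
record rt_system =
  num_tasks :: nat
  num_procs :: nat
  cycles :: "nat \<Rightarrow> real"
  deadline :: "nat \<Rightarrow> real"
  period :: "nat \<Rightarrow> real"
  f_max :: real
  s_min :: real
  p_alpha :: real
  p_beta :: real
  p_static :: real
  p_idle :: real

definition tasks :: "rt_system \<Rightarrow> nat set" where
  "tasks S = {1..num_tasks S}"

definition procs :: "rt_system \<Rightarrow> nat set" where
  "procs S = {1..num_procs S}"

definition common_multiple :: "rt_system \<Rightarrow> real \<Rightarrow> bool" where
  "common_multiple S t \<longleftrightarrow> t > 0 \<and> (\<forall>i\<in>tasks S. \<exists>q::nat. t = real q * period S i)"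

definition hyperperiod :: "rt_system \<Rightarrow> real" where
  "hyperperiod S = (LEAST t. common_multiple S t)"

(* L / p_i is a positive integer, so the floor only changes its type. *)
definition jobs :: "rt_system \<Rightarrow> nat \<Rightarrow> nat set" where
  "jobs S i = {1..nat \<lfloor>hyperperiod S / period S i\<rfloor>}"

definition arrival :: "rt_system \<Rightarrow> nat \<Rightarrow> nat \<Rightarrow> real" where
  "arrival S i j = (real j - 1) * period S i"

definition job_deadline :: "rt_system \<Rightarrow> nat \<Rightarrow> nat \<Rightarrow> real" where
  "job_deadline S i j = (real j - 1) * period S i + deadline S i"

definition min_exec_time :: "rt_system \<Rightarrow> nat \<Rightarrow> real" where
  "min_exec_time S i = cycles S i / f_max S"

definition power_active :: "rt_system \<Rightarrow> real \<Rightarrow> real" where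
  "power_active S s = p_alpha S * s powr p_beta S + p_static S"

definition stage_cost :: "rt_system \<Rightarrow> real \<Rightarrow> real \<Rightarrow> real" where
  "stage_cost S a s = a * (power_active S s - p_idle S)"

definition density :: "rt_system \<Rightarrow> real" where
  "density S = (\<Sum>i\<in>tasks S. min_exec_time S i / min (deadline S i) (period S i))"

(* The existence of a common multiple is what makes the hyperperiod meaningful for
   real periods. Deadlines are not related to periods. *)
definition rt_setting :: "rt_system \<Rightarrow> bool" where
  "rt_setting S \<longleftrightarrow>
     num_tasks S \<ge> 1 \<and> num_procs S \<ge> 1 \<and>
     (\<forall>i\<in>tasks S. cycles S i \<ge> 0 \<and> deadline S i > 0 \<and> period S i > 0) \<and>
     (\<exists>t. common_multiple S t) \<and>
     f_max S > 0 \<and> s_min S \<ge> 0 \<and>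
     p_alpha S > 0 \<and> p_beta S \<ge> 1 \<and> p_static S > 0 \<and> p_idle S > 0 \<and>
     (\<forall>s\<in>{s_min S..1}. power_active S s - p_idle S > 0) \<and>
     density S \<le> real (num_procs S)"


section \<open>The major grid\<close>

(* If d_i > p_i, the last jobs of a task have deadlines beyond the hyperperiod L.
   These are kept as grid points of index greater than N (where tau_N = L), so that
   every job has an arrival index and a deadline index; the points with index at
   most N are exactly those in [0,L], see tau_image below. *)
definition event_times :: "rt_system \<Rightarrow> real set" where
  "event_times S =
     (\<Union>i\<in>tasks S. arrival S i ` jobs S i \<union> job_deadline S i ` jobs S i)
       \<union> {hyperperiod S}"

definition tau :: "rt_system \<Rightarrow> nat \<Rightarrow> real" where
  "tau S \<mu> = sorted_list_of_set (event_times S) ! \<mu>"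

definition grid_index :: "rt_system \<Rightarrow> real \<Rightarrow> nat" where
  "grid_index S t = (THE \<mu>. \<mu> < card (event_times S) \<and> tau S \<mu> = t)"

definition grid_N :: "rt_system \<Rightarrow> nat" where
  "grid_N S = grid_index S (hyperperiod S)"

definition Phi_A :: "rt_system \<Rightarrow> nat \<Rightarrow> nat \<Rightarrow> nat" where
  "Phi_A S i j = grid_index S (arrival S i j)"

definition Phi_D :: "rt_system \<Rightarrow> nat \<Rightarrow> nat \<Rightarrow> nat" where
  "Phi_D S i j = grid_index S (job_deadline S i j)"


section \<open>The continuous-time constraints (C)\<close>

definition absolutely_continuous_on :: "real set \<Rightarrow> (real \<Rightarrow> real) \<Rightarrow> bool" where
  "absolutely_continuous_on X f \<longleftrightarrow>
     (\<forall>\<epsilon>>0. \<exists>\<delta>>0. \<forall>d t. d division_of t \<and> t \<subseteq> X \<and> (\<Sum>k\<in>d. Sup k - Inf k) < \<delta>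
        \<longrightarrow> (\<Sum>k\<in>d. \<bar>f (Sup k) - f (Inf k)\<bar>) < \<epsilon>)"

(* The state solves its differential equation almost everywhere in the sense of
   Caratheodory: it is absolutely continuous on [0,L], and speeds and activations are
   measurable. Outside [0,L] only the literal boundary conditions apply. *)
definition feasible_C ::
  "rt_system \<Rightarrow> (nat \<Rightarrow> nat \<Rightarrow> real \<Rightarrow> real) \<Rightarrow> (nat \<Rightarrow> nat \<Rightarrow> nat \<Rightarrow> real \<Rightarrow> real) \<Rightarrow>
     (nat \<Rightarrow> nat \<Rightarrow> nat \<Rightarrow> real \<Rightarrow> real) \<Rightarrow> bool" where
  "feasible_C S x s a \<longleftrightarrow>
     (let L = hyperperiod S in
       (\<forall>i\<in>tasks S. \<forall>j\<in>jobs S i. absolutely_continuous_on {0..L} (x i j)) \<and>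
       (\<forall>i\<in>tasks S. \<forall>j\<in>jobs S i. \<forall>k\<in>procs S.
          s i j k \<in> borel_measurable (lebesgue_on {0..L}) \<and>
          a i j k \<in> borel_measurable (lebesgue_on {0..L})) \<and>
       (\<forall>i\<in>tasks S. \<forall>j\<in>jobs S i. x i j (arrival S i j) = min_exec_time S i) \<and>
       (\<forall>i\<in>tasks S. \<forall>j\<in>jobs S i. x i j (job_deadline S i j) = 0) \<and>
       (\<forall>i\<in>tasks S. \<forall>j\<in>jobs S i. AE t in lebesgue. t \<in> {0..L} \<longrightarrow>
          (x i j has_real_derivative - (\<Sum>k\<in>procs S. s i j k t * a i j k t)) (at t)) \<and>
       (\<forall>i\<in>tasks S. \<forall>j\<in>jobs S i. \<forall>t\<in>{0..L}. (\<Sum>k\<in>procs S. a i j k t) \<le> 1) \<and>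
       (\<forall>k\<in>procs S. \<forall>t\<in>{0..L}. (\<Sum>i\<in>tasks S. \<Sum>j\<in>jobs S i. a i j k t) \<le> 1) \<and>
       (\<forall>i\<in>tasks S. \<forall>j\<in>jobs S i. \<forall>k\<in>procs S. \<forall>t\<in>{0..L}.
          s_min S \<le> s i j k t \<and> s i j k t \<le> 1) \<and>
       (\<forall>i\<in>tasks S. \<forall>j\<in>jobs S i. \<forall>k\<in>procs S. \<forall>t\<in>{0..L}. a i j k t \<in> {0, 1}))"

definition energy_C ::
  "rt_system \<Rightarrow> (nat \<Rightarrow> nat \<Rightarrow> nat \<Rightarrow> real \<Rightarrow> real) \<Rightarrow> (nat \<Rightarrow> nat \<Rightarrow> nat \<Rightarrow> real \<Rightarrow> real) \<Rightarrow> real" where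
  "energy_C S s a =
     (\<Sum>i\<in>tasks S. \<Sum>j\<in>jobs S i. \<Sum>k\<in>procs S.
        integral {0..hyperperiod S} (\<lambda>t. stage_cost S (a i j k t) (s i j k t)))"


section \<open>The nonlinear program (P)\<close>

definition feasible_P ::
  "rt_system \<Rightarrow> (nat \<Rightarrow> nat \<Rightarrow> nat \<Rightarrow> real) \<Rightarrow> (nat \<Rightarrow> nat \<Rightarrow> nat \<Rightarrow> real) \<Rightarrow>
     (nat \<Rightarrow> nat \<Rightarrow> nat \<Rightarrow> real) \<Rightarrow> bool" where
  "feasible_P S x s a \<longleftrightarrow>
     (\<forall>i\<in>tasks S. \<forall>j\<in>jobs S i. x i j (Phi_A S i j) = min_exec_time S i) \<and>
     (\<forall>i\<in>tasks S. \<forall>j\<in>jobs S i. x i j (Phi_D S i j) = 0) \<and>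
     (\<forall>i\<in>tasks S. \<forall>j\<in>jobs S i. \<forall>\<mu><grid_N S.
        x i j (\<mu> + 1) = x i j \<mu> - (tau S (\<mu> + 1) - tau S \<mu>) * s i j \<mu> * a i j \<mu>) \<and>
     (\<forall>\<mu><grid_N S. (\<Sum>i\<in>tasks S. \<Sum>j\<in>jobs S i. a i j \<mu>) \<le> real (num_procs S)) \<and>
     (\<forall>i\<in>tasks S. \<forall>j\<in>jobs S i. \<forall>\<mu><grid_N S. s_min S \<le> s i j \<mu> \<and> s i j \<mu> \<le> 1) \<and>
     (\<forall>i\<in>tasks S. \<forall>j\<in>jobs S i. \<forall>\<mu><grid_N S. 0 \<le> a i j \<mu> \<and> a i j \<mu> \<le> 1)"

definition cost_P ::
  "rt_system \<Rightarrow> (nat \<Rightarrow> nat \<Rightarrow> nat \<Rightarrow> real) \<Rightarrow> (nat \<Rightarrow> nat \<Rightarrow> nat \<Rightarrow> real) \<Rightarrow> real" where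
  "cost_P S s a =
     (\<Sum>\<mu><grid_N S. \<Sum>i\<in>tasks S. \<Sum>j\<in>jobs S i.
        (tau S (\<mu> + 1) - tau S \<mu>) * stage_cost S (a i j \<mu>) (s i j \<mu>))"

definition optimal_P ::
  "rt_system \<Rightarrow> (nat \<Rightarrow> nat \<Rightarrow> nat \<Rightarrow> real) \<Rightarrow> (nat \<Rightarrow> nat \<Rightarrow> nat \<Rightarrow> real) \<Rightarrow>
     (nat \<Rightarrow> nat \<Rightarrow> nat \<Rightarrow> real) \<Rightarrow> bool" where
  "optimal_P S x s a \<longleftrightarrow>
     feasible_P S x s a \<and>
     (\<forall>x' s' a'. feasible_P S x' s' a' \<longrightarrow> cost_P S s a \<le> cost_P S s' a')"


section \<open>The hyperperiod and the grid are as intended\<close>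

lemma hyperperiod_least:
  assumes "rt_setting S"
  shows "common_multiple S (hyperperiod S)"
    and "\<And>t. common_multiple S t \<Longrightarrow> hyperperiod S \<le> t"
proof -
  from assms have one: "1 \<in> tasks S" and p1: "period S 1 > 0"
    by (auto simp: rt_setting_def tasks_def)
  define Q where "Q q \<longleftrightarrow> common_multiple S (real q * period S 1)" for q :: nat
  obtain t where t: "common_multiple S t" using assms by (auto simp: rt_setting_def)
  with one obtain q where "t = real q * period S 1" by (auto simp: common_multiple_def)
  with t have Qq: "Q q" by (simp add: Q_def)
  define h where "h = real (LEAST q. Q q) * period S 1"
  have h1: "common_multiple S h"
    using LeastI[of Q, OF Qq] by (simp add: Q_def h_def)
  have h2: "h \<le> u" if u: "common_multiple S u" for u
  proof -
    from u one obtain r where r: "u = real r * period S 1" by (auto simp: common_multiple_def)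
    with u have "Q r" by (simp add: Q_def)
    then have "(LEAST q. Q q) \<le> r" by (rule Least_le)
    then show ?thesis using p1 by (simp add: r h_def)
  qed
  have "hyperperiod S = h"
    unfolding hyperperiod_def using h1 h2 by (rule Least_equality)
  then show "common_multiple S (hyperperiod S)"
    and "\<And>t. common_multiple S t \<Longrightarrow> hyperperiod S \<le> t"
    using h1 h2 by auto
qed

lemma finite_event_times: "finite (event_times S)"
  by (simp add: event_times_def tasks_def jobs_def)

lemma event_times_nonneg:
  assumes "rt_setting S" "t \<in> event_times S"
  shows "0 \<le> t"
proof -
  have L: "0 < hyperperiod S"
    using hyperperiod_least(1)[OF assms(1)] by (simp add: common_multiple_def)
  have "0 \<le> arrival S i j \<and> 0 \<le> job_deadline S i j"
    if "i \<in> tasks S" "j \<in> jobs S i" for i j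
  proof -
    have "period S i > 0" "deadline S i > 0" "real j \<ge> 1"
      using assms(1) that by (auto simp: rt_setting_def jobs_def)
    then show ?thesis by (simp add: arrival_def job_deadline_def)
  qed
  with L assms(2) show ?thesis by (auto simp: event_times_def)
qed

lemma zero_in_event_times:
  assumes "rt_setting S"
  shows "0 \<in> event_times S"
proof -
  have one: "1 \<in> tasks S" and p: "period S 1 > 0"
    using assms by (auto simp: rt_setting_def tasks_def)
  from hyperperiod_least(1)[OF assms] one obtain q where
    q: "hyperperiod S = real q * period S 1" and L: "hyperperiod S > 0"
    by (auto simp: common_multiple_def)
  have "q \<ge> 1" using q L by (cases q) auto
  then have "1 \<in> jobs S 1" using q p by (simp add: jobs_def)
  moreover have "arrival S 1 1 = 0" by (simp add: arrival_def)
  ultimately have "0 \<in> arrival S 1 ` jobs S 1" by (metis image_eqI)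
  then show ?thesis using one unfolding event_times_def by blast
qed

lemma tau_strict_mono:
  assumes "\<mu> < \<nu>" "\<nu> < card (event_times S)"
  shows "tau S \<mu> < tau S \<nu>"
  using sorted_wrt_nth_less[OF strict_sorted_list_of_set assms(1), of "event_times S"] assms(2)
  by (simp add: tau_def)

lemma grid_index:
  assumes "t \<in> event_times S"
  shows "grid_index S t < card (event_times S)" "tau S (grid_index S t) = t"
proof -
  have "t \<in> set (sorted_list_of_set (event_times S))"
    using assms finite_event_times by simp
  then obtain \<mu> where "\<mu> < length (sorted_list_of_set (event_times S))"
    "sorted_list_of_set (event_times S) ! \<mu> = t"
    by (metis in_set_conv_nth)
  then have \<mu>: "\<mu> < card (event_times S) \<and> tau S \<mu> = t"
    by (simp add: tau_def)
  have "\<nu> = \<mu>" if \<nu>: "\<nu> < card (event_times S) \<and> tau S \<nu> = t" for \<nu>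
  proof (rule ccontr)
    assume "\<nu> \<noteq> \<mu>"
    then consider "\<nu> < \<mu>" | "\<mu> < \<nu>" by linarith
    then show False
    proof cases
      case 1
      then show ?thesis using tau_strict_mono[of \<nu> \<mu> S] \<mu> \<nu> by linarith
    next
      case 2
      then show ?thesis using tau_strict_mono[of \<mu> \<nu> S] \<mu> \<nu> by linarith
    qed
  qed
  then have "grid_index S t < card (event_times S) \<and> tau S (grid_index S t) = t"
    unfolding grid_index_def by (rule theI[where P = \<open>\<lambda>\<nu>. \<nu> < card (event_times S) \<and> tau S \<nu> = t\<close>, OF \<mu>])
  then show "grid_index S t < card (event_times S)" "tau S (grid_index S t) = t"
    by blast+
qed

lemma tau_in_event_times:
  assumes "\<mu> < card (event_times S)"
  shows "tau S \<mu> \<in> event_times S"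
proof -
  have "tau S \<mu> \<in> set (sorted_list_of_set (event_times S))"
    unfolding tau_def using assms by (intro nth_mem) simp
  then show ?thesis using finite_event_times by simp
qed

lemma tau_N: "tau S (grid_N S) = hyperperiod S"
  and N_less: "grid_N S < card (event_times S)"
  using grid_index[of "hyperperiod S" S] by (auto simp: grid_N_def event_times_def)

lemma tau_0:
  assumes "rt_setting S"
  shows "tau S 0 = 0"
proof -
  let ?z = "grid_index S 0"
  have z: "?z < card (event_times S)" "tau S ?z = 0"
    using grid_index[OF zero_in_event_times[OF assms]] by auto
  have "0 \<le> tau S 0"
    using event_times_nonneg[OF assms] tau_in_event_times[of 0 S] z(1) by auto
  then show ?thesis using z tau_strict_mono[of 0 ?z S] by (cases "?z = 0") auto
qed

lemma tau_image:
  assumes "rt_setting S"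
  shows "tau S ` {..grid_N S} = event_times S \<inter> {0..hyperperiod S}"
proof (intro equalityI subsetI)
  fix t assume "t \<in> tau S ` {..grid_N S}"
  then obtain \<mu> where \<mu>: "\<mu> \<le> grid_N S" "t = tau S \<mu>" by auto
  then have "t \<in> event_times S"
    using tau_in_event_times[of \<mu> S] N_less[of S] by simp
  moreover have "t \<le> hyperperiod S"
    using \<mu> tau_strict_mono[of \<mu> "grid_N S" S] N_less[of S] tau_N[of S]
    by (cases "\<mu> = grid_N S") auto
  ultimately show "t \<in> event_times S \<inter> {0..hyperperiod S}"
    using event_times_nonneg[OF assms] by auto
next
  fix t assume t: "t \<in> event_times S \<inter> {0..hyperperiod S}"
  then have g: "grid_index S t < card (event_times S)" "tau S (grid_index S t) = t"
    using grid_index by auto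
  have "grid_index S t \<le> grid_N S"
  proof (rule ccontr)
    assume "\<not> ?thesis"
    then have "tau S (grid_N S) < tau S (grid_index S t)"
      using g(1) by (intro tau_strict_mono) auto
    then show False using t g(2) tau_N[of S] by auto
  qed
  with g show "t \<in> tau S ` {..grid_N S}" by force
qed

lemma tau_Phi:
  assumes "i \<in> tasks S" "j \<in> jobs S i"
  shows "tau S (Phi_A S i j) = arrival S i j" "tau S (Phi_D S i j) = job_deadline S i j"
proof -
  have "arrival S i j \<in> event_times S" "job_deadline S i j \<in> event_times S"
    using assms unfolding event_times_def by auto
  then show "tau S (Phi_A S i j) = arrival S i j" "tau S (Phi_D S i j) = job_deadline S i j"
    unfolding Phi_A_def Phi_D_def by (simp_all add: grid_index)
qed

end

theory Submission
  imports Defs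
begin

text \<open>From a schedule to the program: average over each grid interval. The activation is the
  fraction of the interval during which the job runs, the speed is the work done divided by the
  time it runs; as a weighted mean of speeds it stays in \<open>[s_min, 1]\<close>. Optimal points then exist by
  compactness, since the state is a continuous function of speeds and activations.

  From the program to a schedule: on every grid interval each job keeps its constant speed and the
  execution times are packed onto the processors by McNaughton's wrap-around rule. As the cost is
  linear in the activation, the energy is unchanged.\<close>

section \<open>Absolutely continuous functions\<close>

text \<open>A recurring obstacle is a job whose deadline lies beyond \<open>L\<close>: the
  recurrence of the program and the differential equation both stop at \<open>L\<close>, yet the
  deadline condition still prescribes a value at a later point. That value is independent of
  everything up to \<open>L\<close>, so \<open>traj\<close> and the constructed schedule both take
  the value 0 there. The state in (C) has a derivative only almost everywhere; absolute continuity
  is what turns its drop over a grid interval into the integral of the work done, since a function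
  of Cantor type could fall without any work. For the optimum, coordinates at indices outside the
  program are unconstrained, so compactness becomes available only after they are reset to default
  values. In the converse direction grid intervals can be treated separately: arrivals, and
  deadlines up to \<open>L\<close>, are grid points, so the order of execution inside an interval
  matters only through the total work of each job.\<close>

text \<open>Henstock--Kurzweil argument: tags in the exceptional set get a gauge inside an open set of small
  measure, where absolute continuity bounds the increments of \<open>f\<close>.\<close>
lemma absolutely_continuous_has_integral:
  fixes f :: "real \<Rightarrow> real"
  assumes ac: "absolutely_continuous_on {a..b} f" and ab: "a \<le> b" and neg: "negligible N"
    and deriv: "\<And>t. t \<in> {a..b} - N \<Longrightarrow> (f has_real_derivative g t) (at t within {a..b})"
  shows "(g has_integral f b - f a) {a..b}"
proof -
  \<comment> \<open>\<open>g\<close> is arbitrary on \<open>N\<close>; with 0 there, a tag in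
    \<open>N\<close> contributes only an increment of \<open>f\<close>.\<close>
  define h where "h t = (if t \<in> N then 0 else g t)" for t
  have "(h has_integral f b - f a) {a..b}"
    unfolding has_integral_real
  proof (intro allI impI)
    fix e :: real assume e: "e > 0"
    \<comment> \<open>The \<open>+ 1\<close> keeps the denominator positive when
      \<open>a = b\<close> and makes the total error of the good tags strictly less than
      \<open>e / 2\<close>.\<close>
    define e1 where "e1 = e / (2 * (b - a + 1))"
    have e1: "e1 > 0" "e1 * (b - a) < e / 2"
      using e ab by (auto simp: e1_def field_simps)
    obtain \<delta> where \<delta>: "\<delta> > 0" and ac\<delta>: "\<And>d t. d division_of t \<Longrightarrow> t \<subseteq> {a..b} \<Longrightarrow>
        (\<Sum>k\<in>d. Sup k - Inf k) < \<delta> \<Longrightarrow> (\<Sum>k\<in>d. \<bar>f (Sup k) - f (Inf k)\<bar>) < e / 2"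
      using ac e unfolding absolutely_continuous_on_def by (meson half_gt_zero)
    \<comment> \<open>Outer regularity bounds \<open>T - N\<close>; since \<open>N\<close> is
      negligible, \<open>T\<close> itself has measure below \<delta>.\<close>
    obtain T where T: "open T" "N \<subseteq> T" "T - N \<in> lmeasurable" "emeasure lebesgue (T - N) < ennreal \<delta>"
      using sets_lebesgue_outer_open[OF negligible_imp_sets[OF neg] \<delta>] by blast
    have Tm: "T \<in> lmeasurable"
      using T(2,3) negligible_imp_measurable[OF neg] fmeasurable.Un[of "T - N" lebesgue N]
      by (simp add: Un_absorb2)
    have "measure lebesgue T = measure lebesgue (T - N)"
      using neg by (metis Diff_Diff_Int Int_absorb1 T(2) T(3) Un_Diff_cancel2 Un_absorb2 measure_Un_null_set
          fmeasurableD negligible_iff_null_sets)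
    then have T\<delta>: "measure lebesgue T < \<delta>"
      using T(3,4) \<delta> by (simp add: emeasure_eq_measure2 fmeasurableD2 ennreal_less_iff)
    have "\<forall>x. \<exists>r>0. x \<in> {a..b} - N \<longrightarrow>
         (\<forall>y\<in>{a..b}. norm (y - x) < r \<longrightarrow> norm (f y - f x - (y - x) * g x) \<le> e1 * norm (y - x))"
      using deriv[unfolded has_field_derivative_def has_derivative_within_alt] e1(1)
      by (metis (no_types, opaque_lifting) mult.commute zero_less_one)
    then obtain r where r: "\<And>x. 0 < r x"
      "\<And>x y. \<lbrakk>x \<in> {a..b} - N; y \<in> {a..b}; norm (y - x) < r x\<rbrakk>
         \<Longrightarrow> norm (f y - f x - (y - x) * g x) \<le> e1 * norm (y - x)"
      by metis
    define \<gamma> where "\<gamma> x = (if x \<in> N then T else ball x (r x))" for x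
    have "gauge \<gamma>"
      using T(1,2) r(1) by (auto simp: gauge_def \<gamma>_def)
    moreover have "norm ((\<Sum>(x,K)\<in>p. measure lborel K *\<^sub>R h x) - (f b - f a)) < e"
      if p: "p tagged_division_of {a..b}" "\<gamma> fine p" for p
    proof -
      note pd = tagged_division_ofD[OF p(1)]
      let ?q = "{z\<in>p. fst z \<in> N}"
      let ?w = "\<lambda>(x,K). f (Sup K) - f (Inf K)"
      have fb: "f b - f a = sum ?w p" "b - a = (\<Sum>(x,K)\<in>p. Sup K - Inf K)"
        using additive_tagged_division_1[OF ab p(1), of f]
          additive_tagged_division_1[OF ab p(1), of "\<lambda>x. x"] by auto
      \<comment> \<open>Straddle estimate: the tag splits the interval into two pieces, each with an
        error proportional to its length, so the errors add up to \<open>e1\<close> times the full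
        length.\<close>
      have good: "\<bar>measure lborel K * h x - (f (Sup K) - f (Inf K))\<bar> \<le> e1 * (Sup K - Inf K)"
        if xK: "(x,K) \<in> p" "x \<notin> N" for x K
      proof -
        obtain u v where K: "K = cbox u v" using pd(4) xK(1) by blast
        have x: "x \<in> K" "K \<subseteq> {a..b}" using pd xK(1) by auto
        then have uv: "u \<le> v" "u \<in> K" "v \<in> K" by (auto simp: K)
        have sub: "K \<subseteq> ball x (r x)" using p(2) xK unfolding fine_def \<gamma>_def by fastforce
        have 1: "norm (f u - f x - (u - x) * g x) \<le> e1 * norm (u - x)"
          using x uv sub xK by (intro r(2)) (auto simp: dist_real_def subset_iff)
        have 2: "norm (f v - f x - (v - x) * g x) \<le> e1 * norm (v - x)"
          using x uv sub xK by (intro r(2)) (auto simp: dist_real_def subset_iff)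
        have "(v - u) * g x - (f v - f u)
            = (f u - f x - (u - x) * g x) - (f v - f x - (v - x) * g x)"
          by (simp add: algebra_simps)
        then have "\<bar>(v - u) * g x - (f v - f u)\<bar> \<le> e1 * norm (u - x) + e1 * norm (v - x)"
          using 1 2 by (smt (verit) real_norm_def)
        also have "\<dots> = e1 * (v - u)"
          using x(1) by (simp add: K algebra_simps)
        finally show ?thesis
          using uv(1) xK(2) by (simp add: K h_def)
      qed
      have "?q tagged_partial_division_of {a..b}"
        using p(1) tagged_partial_division_subset[of p "{a..b}" ?q]
        by (auto simp: tagged_division_of_def)
      note q = tagged_partial_division_of_Union_self[OF this]
      have qd: "snd ` ?q division_of \<Union>(snd ` ?q)"
        using division_of_tagged_division[OF q] .
      have qT: "\<Union>(snd ` ?q) \<subseteq> T"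
        using p(2) by (force simp: fine_def \<gamma>_def)
      have qab: "\<Union>(snd ` ?q) \<subseteq> {a..b}"
        using pd(3) by force
      have "(\<Sum>K\<in>snd ` ?q. Sup K - Inf K) = (\<Sum>K\<in>snd ` ?q. measure lebesgue K)"
      proof (rule sum.cong[OF refl])
        fix K assume K: "K \<in> snd ` ?q"
        obtain u v where "K = cbox u v" "K \<noteq> {}"
          using division_ofD(3,4)[OF qd K] by metis
        then show "Sup K - Inf K = measure lebesgue K" by simp
      qed
      also have "\<dots> = measure lebesgue (\<Union>(snd ` ?q))"
        by (rule content_division[OF qd])
      also have "\<dots> \<le> measure lebesgue T"
        using qT Tm lmeasurable_division[OF qd] by (intro measure_mono_fmeasurable) auto
      also have "\<dots> < \<delta>" by (rule T\<delta>)
      finally have small: "(\<Sum>K\<in>snd ` ?q. \<bar>f (Sup K) - f (Inf K)\<bar>) < e / 2"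
        by (intro ac\<delta>[OF qd qab])
      \<comment> \<open>Different tags can share a degenerate interval, so passing from tagged pairs
        to intervals needs a weight vanishing on these. The case split covers the empty set, where
        \<open>Sup\<close> and \<open>Inf\<close> carry no information.\<close>
      define V where "V K = (if K = {} then 0 else \<bar>f (Sup K) - f (Inf K)\<bar>)" for K
      have "(\<Sum>(x,K)\<in>?q. \<bar>f (Sup K) - f (Inf K)\<bar>) = (\<Sum>(x,K)\<in>?q. V K)"
        using pd(2) by (intro sum.cong) (auto simp: V_def dest: pd(2))
      also have "\<dots> = (\<Sum>K\<in>snd ` ?q. V K)"
      proof (rule sum.over_tagged_division_lemma[OF q])
        fix u v :: real assume "box u v = {}"
        then show "V (cbox u v) = 0"
          by (cases "u = v") (auto simp: V_def box_eq_empty)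
      qed
      also have "\<dots> \<le> (\<Sum>K\<in>snd ` ?q. \<bar>f (Sup K) - f (Inf K)\<bar>)"
        by (intro sum_mono) (simp add: V_def)
      finally have bad: "(\<Sum>(x,K)\<in>?q. \<bar>f (Sup K) - f (Inf K)\<bar>) < e / 2"
        using small by linarith
      have "norm ((\<Sum>(x,K)\<in>p. measure lborel K *\<^sub>R h x) - (f b - f a))
          = \<bar>\<Sum>(x,K)\<in>p. measure lborel K * h x - (f (Sup K) - f (Inf K))\<bar>"
        unfolding fb(1) by (simp add: sum_subtractf split_def)
      also have "\<dots> \<le> (\<Sum>(x,K)\<in>p. \<bar>measure lborel K * h x - (f (Sup K) - f (Inf K))\<bar>)"
        using sum_abs[of "\<lambda>(x,K). measure lborel K * h x - (f (Sup K) - f (Inf K))" p]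
        by (simp add: split_def)
      also have "\<dots> \<le> (\<Sum>(x,K)\<in>p. (if x \<in> N then \<bar>f (Sup K) - f (Inf K)\<bar> else 0) + e1 * (Sup K - Inf K))"
      proof (rule sum_mono, clarify)
        fix x K assume xK: "(x,K) \<in> p"
        then obtain u v where "K = cbox u v" "K \<noteq> {}" using pd(2,4) by (metis empty_iff)
        then have "Sup K - Inf K \<ge> 0" by auto
        then have "0 \<le> e1 * (Sup K - Inf K)" using e1(1) by simp
        with good[OF xK] show "\<bar>measure lborel K * h x - (f (Sup K) - f (Inf K))\<bar>
           \<le> (if x \<in> N then \<bar>f (Sup K) - f (Inf K)\<bar> else 0) + e1 * (Sup K - Inf K)"
          by (simp add: h_def abs_minus_commute)
      qed
      also have "\<dots> = (\<Sum>(x,K)\<in>?q. \<bar>f (Sup K) - f (Inf K)\<bar>) + e1 * (b - a)"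
        unfolding fb(2)
        unfolding sum.inter_filter[OF pd(1)] sum_distrib_left sum.distrib[symmetric]
        by (intro sum.cong) auto
      also have "\<dots> < e" using bad e1(2) by linarith
      finally show ?thesis .
    qed
    ultimately show "\<exists>\<gamma>. gauge \<gamma> \<and> (\<forall>p. p tagged_division_of {a..b} \<and> \<gamma> fine p \<longrightarrow>
        norm ((\<Sum>(x,K)\<in>p. measure lborel K *\<^sub>R h x) - (f b - f a)) < e)"
      by (intro exI[of _ \<gamma>] conjI allI impI) (assumption, elim conjE)
  qed
  then show ?thesis
    by (rule has_integral_spike[OF neg, rotated]) (auto simp: h_def)
qed

lemma absolutely_continuous_on_subset:
  "absolutely_continuous_on X f \<Longrightarrow> Y \<subseteq> X \<Longrightarrow> absolutely_continuous_on Y f"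
  unfolding absolutely_continuous_on_def by (meson order_trans)

section \<open>Lipschitz trajectories assembled from ramps\<close>

lemma lipschitz_imp_absolutely_continuous_on:
  assumes lip: "\<And>u v. \<lbrakk>u \<in> X; v \<in> X\<rbrakk> \<Longrightarrow> \<bar>f u - f v\<bar> \<le> C * \<bar>u - v\<bar>"
  shows "absolutely_continuous_on X f"
  unfolding absolutely_continuous_on_def
proof (intro allI impI)
  fix \<epsilon> :: real assume \<epsilon>: "\<epsilon> > 0"
  \<comment> \<open>\<open>C\<close> may be zero or negative, so a positive constant is needed
    before dividing by it.\<close>
  define D where "D = \<bar>C\<bar> + 1"
  have D: "D > 0" "C \<le> D" by (auto simp: D_def)
  have "(\<Sum>k\<in>d. \<bar>f (Sup k) - f (Inf k)\<bar>) < \<epsilon>"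
    if d: "d division_of t" "t \<subseteq> X" "(\<Sum>k\<in>d. Sup k - Inf k) < \<epsilon> / D" for d t
  proof -
    have "\<bar>f (Sup k) - f (Inf k)\<bar> \<le> D * (Sup k - Inf k)" if k: "k \<in> d" for k
    proof -
      obtain u v where uv: "k = cbox u v" "k \<noteq> {}" using division_ofD(3,4)[OF d(1) k] by metis
      have "k \<subseteq> X" using division_ofD(2)[OF d(1) k] d(2) by blast
      then have "\<bar>f v - f u\<bar> \<le> C * \<bar>v - u\<bar>" using uv by (intro lip) auto
      also have "\<dots> \<le> D * \<bar>v - u\<bar>" using D(2) by (intro mult_right_mono) auto
      finally show ?thesis using uv by simp
    qed
    then have "(\<Sum>k\<in>d. \<bar>f (Sup k) - f (Inf k)\<bar>) \<le> D * (\<Sum>k\<in>d. Sup k - Inf k)"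
      unfolding sum_distrib_left by (rule sum_mono)
    also have "\<dots> < \<epsilon>" using d(3) D(1) by (simp add: field_simps)
    finally show ?thesis .
  qed
  then show "\<exists>\<delta>>0. \<forall>d t. d division_of t \<and> t \<subseteq> X \<and> (\<Sum>k\<in>d. Sup k - Inf k) < \<delta>
      \<longrightarrow> (\<Sum>k\<in>d. \<bar>f (Sup k) - f (Inf k)\<bar>) < \<epsilon>"
    using \<epsilon> D(1) by (intro exI[of _ "\<epsilon> / D"]) auto
qed

text \<open>For \<open>l \<le> h\<close> this is the time spent in \<open>{l..<h}\<close> up to
  \<open>t\<close>: the antiderivative of the indicator that vanishes to the left of
  \<open>l\<close>.\<close>

definition ramp :: "real \<Rightarrow> real \<Rightarrow> real \<Rightarrow> real" where
  "ramp l h t = max l (min h t) - l"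

lemma ramp_lipschitz: "\<bar>ramp l h u - ramp l h v\<bar> \<le> \<bar>u - v\<bar>"
  unfolding ramp_def by linarith

lemma sum_ramp_lipschitz:
  fixes w :: "'q \<Rightarrow> real"
  shows "\<bar>(\<Sum>q\<in>A. w q * ramp (l q) (h q) u) - (\<Sum>q\<in>A. w q * ramp (l q) (h q) v)\<bar>
    \<le> (\<Sum>q\<in>A. \<bar>w q\<bar>) * \<bar>u - v\<bar>"
proof -
  have "\<bar>w q * ramp (l q) (h q) u - w q * ramp (l q) (h q) v\<bar> \<le> \<bar>w q\<bar> * \<bar>u - v\<bar>" for q
    using mult_left_mono[OF ramp_lipschitz[of "l q" "h q" u v] abs_ge_zero[of "w q"]]
    by (simp add: abs_mult[symmetric] right_diff_distrib)
  then have "(\<Sum>q\<in>A. \<bar>w q * ramp (l q) (h q) u - w q * ramp (l q) (h q) v\<bar>) \<le> (\<Sum>q\<in>A. \<bar>w q\<bar> * \<bar>u - v\<bar>)"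
    by (intro sum_mono)
  then show ?thesis
    unfolding sum_subtractf[symmetric] sum_distrib_right by (rule order_trans[OF sum_abs])
qed

lemma ramp_has_real_derivative:
  assumes "l \<le> h" "t \<noteq> l" "t \<noteq> h"
  shows "(ramp l h has_real_derivative indicat_real {l..<h} t) (at t)"
proof -
  consider "t < l" | "l < t" "t < h" | "h < t" using assms by linarith
  then show ?thesis
  proof cases
    case 1
    have "((\<lambda>_. 0) has_real_derivative indicat_real {l..<h} t) (at t)"
      using 1 by simp
    then show ?thesis
      by (rule has_field_derivative_transform_within_open[where S = "{..<l}"])
        (use 1 assms in \<open>auto simp: ramp_def\<close>)
  next
    case 2
    have "((\<lambda>u. u - l) has_real_derivative indicat_real {l..<h} t) (at t)"
      using 2 by (auto intro!: derivative_eq_intros)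
    then show ?thesis
      by (rule has_field_derivative_transform_within_open[where S = "{l<..<h}"])
        (use 2 in \<open>auto simp: ramp_def\<close>)
  next
    case 3
    have "((\<lambda>_. h - l) has_real_derivative indicat_real {l..<h} t) (at t)"
      using 3 by simp
    then show ?thesis
      by (rule has_field_derivative_transform_within_open[where S = "{h<..}"])
        (use 3 assms in \<open>auto simp: ramp_def\<close>)
  qed
qed

lemma has_integral_indicator_ivl:
  fixes l h L :: real
  assumes "0 \<le> l" "l \<le> h" "h \<le> L"
  shows "(indicat_real {l..<h} has_integral h - l) {0..L}"
proof -
  have "((\<lambda>_. 1::real) has_integral h - l) {l..h}"
    using has_integral_const_real[of "1::real" l h] assms by simp
  then have "((\<lambda>t. if t \<in> {l..h} then 1 else 0::real) has_integral h - l) {0..L}"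
    using assms by (subst has_integral_restrict) auto
  then show ?thesis
    by (rule has_integral_spike[of "{h}", rotated 2]) (auto simp: indicator_def)
qed

text \<open>Serves both exclusion constraints: indexed by processors it keeps a job from running in
  parallel with itself, indexed by jobs it keeps a processor from serving two at once.\<close>

lemma sum_indicator_disjoint_le:
  assumes "finite K" "disjoint_family_on J K"
  shows "(\<Sum>k\<in>K. indicat_real (J k) t) \<le> 1"
proof -
  have "(\<Sum>k\<in>K. indicat_real (J k) t) = indicat_real (\<Union>(J ` K)) t"
    using indicator_UN_disjoint[OF assms] by metis
  then show ?thesis by (simp add: indicator_def)
qed

section \<open>McNaughton's wrap-around rule\<close>

text \<open>The summand is the length of the part of \<open>[0, y]\<close> in the
  \<open>k\<close>-th unit cell \<open>[k - 1, k]\<close>.\<close>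

lemma sum_clamp:
  fixes y :: real
  assumes "0 \<le> y"
  shows "(\<Sum>k=1..m. min 1 (max 0 (y - (real k - 1)))) = min y (real m)"
  using assms by (induction m) auto

text \<open>\<open>P q\<close> is the left end of a segment of length \<open>w q\<close>. Each new
  element is appended at the current total \<open>sum w Q\<close>, so no enumeration of
  \<open>Q\<close> has to be chosen.\<close>

lemma disjoint_intervals_exist:
  fixes w :: "'q \<Rightarrow> real"
  assumes "finite Q" "\<And>q. q \<in> Q \<Longrightarrow> 0 \<le> w q"
  shows "\<exists>P. (\<forall>q\<in>Q. 0 \<le> P q \<and> P q + w q \<le> sum w Q) \<and>
             (\<forall>q\<in>Q. \<forall>r\<in>Q. q \<noteq> r \<longrightarrow> P q + w q \<le> P r \<or> P r + w r \<le> P q)"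
  using assms
proof (induction Q rule: finite_induct)
  case (insert z Q)
  then obtain P where P: "\<forall>q\<in>Q. 0 \<le> P q \<and> P q + w q \<le> sum w Q"
    "\<forall>q\<in>Q. \<forall>r\<in>Q. q \<noteq> r \<longrightarrow> P q + w q \<le> P r \<or> P r + w r \<le> P q"
    by auto
  have "0 \<le> sum w Q" "0 \<le> w z" using insert.prems by (auto intro: sum_nonneg)
  moreover define P' where "P' = P(z := sum w Q)"
  ultimately have bounds: "0 \<le> P' q \<and> P' q + w q \<le> sum w (insert z Q)" if "q \<in> insert z Q" for q
  proof (cases "q = z")
    case False
    then have "0 \<le> P q \<and> P q + w q \<le> sum w Q" using P(1) that by blast
    then show ?thesis using False \<open>0 \<le> w z\<close> insert.hyps by (simp add: P'_def)
  qed (use insert.hyps \<open>0 \<le> sum w Q\<close> in \<open>simp add: P'_def\<close>)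
  have "P' q + w q \<le> P' r \<or> P' r + w r \<le> P' q"
    if qr: "q \<in> insert z Q" "r \<in> insert z Q" "q \<noteq> r" for q r
  proof -
    consider "q = z" "r \<in> Q" "r \<noteq> z" | "r = z" "q \<in> Q" "q \<noteq> z" | "q \<in> Q" "r \<in> Q" "q \<noteq> z" "r \<noteq> z"
      using qr by blast
    then show ?thesis
    proof cases
      case 1
      then have "P r + w r \<le> sum w Q" using P(1) by blast
      then show ?thesis using 1 by (simp add: P'_def)
    next
      case 2
      then have "P q + w q \<le> sum w Q" using P(1) by blast
      then show ?thesis using 2 by (simp add: P'_def)
    next
      case 3
      then have "P q + w q \<le> P r \<or> P r + w r \<le> P q" using P(2) qr(3) by blast
      then show ?thesis using 3 by (simp add: P'_def)
    qed
  qed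
  with bounds show ?case by blast
qed auto

text \<open>Times are fractions of one grid interval. One interval per job and processor suffices
  because a segment meets a unit cell in an interval; half-open intervals let neighbours
  touch.\<close>

definition wrap_split ::
  "'q set \<Rightarrow> nat \<Rightarrow> ('q \<Rightarrow> real) \<Rightarrow> ('q \<Rightarrow> nat \<Rightarrow> real) \<Rightarrow> ('q \<Rightarrow> nat \<Rightarrow> real) \<Rightarrow> bool" where
  "wrap_split Q m w lo hi \<longleftrightarrow>
     (\<forall>q\<in>Q. \<forall>k. 0 \<le> lo q k \<and> lo q k \<le> hi q k \<and> hi q k \<le> 1) \<and>
     (\<forall>q\<in>Q. (\<Sum>k=1..m. hi q k - lo q k) = w q) \<and>
     (\<forall>k. disjoint_family_on (\<lambda>q. {lo q k..<hi q k}) Q) \<and>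
     (\<forall>q\<in>Q. disjoint_family (\<lambda>k. {lo q k..<hi q k}))"

text \<open>The jobs are laid end to end on \<open>[0, m)\<close>, and processor \<open>k\<close>
  executes the part inside \<open>[k - 1, k)\<close>.  A job split between two processors does not overlap
  with itself because its total length is at most one.\<close>
lemma wrap_around:
  fixes w :: "'q \<Rightarrow> real"
  assumes Q: "finite Q" and w: "\<And>q. q \<in> Q \<Longrightarrow> 0 \<le> w q \<and> w q \<le> 1" and m: "sum w Q \<le> real m"
  shows "\<exists>lo hi. wrap_split Q m w lo hi"
proof -
  obtain P where P: "\<And>q. q \<in> Q \<Longrightarrow> 0 \<le> P q" "\<And>q. q \<in> Q \<Longrightarrow> P q + w q \<le> sum w Q"
    "\<And>q r. \<lbrakk>q \<in> Q; r \<in> Q; q \<noteq> r\<rbrakk> \<Longrightarrow> P q + w q \<le> P r \<or> P r + w r \<le> P q"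
    using disjoint_intervals_exist[of Q w, OF Q] w by metis
  \<comment> \<open>Position of the global point \<open>y\<close> relative to cell \<open>k\<close>,
    cut off to \<open>[0, 1]\<close>.\<close>
  define g where "g y k = min 1 (max 0 (y - (real k - 1)))" for y k
  define lo where "lo q k = g (P q) k" for q k
  define hi where "hi q k = g (P q + w q) k" for q k
  have g_le: "y \<le> real k - 1 + \<theta>" if "g y k \<le> \<theta>" "\<theta> < 1" for y k \<theta>
    using that unfolding g_def by linarith
  have less_g: "real k - 1 + \<theta> < y" "\<theta> < 1" if "\<theta> < g y k" "0 \<le> \<theta>" for y k \<theta>
    using that unfolding g_def by linarith+
  have g_nonneg: "0 \<le> g y k" for y k
    unfolding g_def by linarith
  \<comment> \<open>Undoes the folding: a local time \<theta> on processor \<open>k\<close> comes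
    from the point \<open>real k - 1 + \<theta>\<close> of the segment of \<open>q\<close>. Both
    kinds of disjointness reduce to this; strictness at the right end handles segments of length
    exactly one.\<close>
  have iv: "P q \<le> real k - 1 + \<theta>" "real k - 1 + \<theta> < P q + w q"
    if "\<theta> \<in> {lo q k..<hi q k}" for q k \<theta>
  proof -
    have "g (P q) k \<le> \<theta>" "\<theta> < g (P q + w q) k" using that by (auto simp: lo_def hi_def)
    moreover from this(1) g_nonneg[of "P q" k] have "0 \<le> \<theta>" by linarith
    ultimately show "P q \<le> real k - 1 + \<theta>" "real k - 1 + \<theta> < P q + w q"
      using g_le less_g by blast+
  qed
  have "0 \<le> lo q k \<and> lo q k \<le> hi q k \<and> hi q k \<le> 1" if "q \<in> Q" for q k
    using w[OF that] unfolding lo_def hi_def g_def by linarith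
  moreover have "(\<Sum>k=1..m. hi q k - lo q k) = w q" if "q \<in> Q" for q
  proof -
    have "P q + w q \<le> real m" using P(2)[OF that] m by linarith
    with P(1)[OF that] w[OF that] sum_clamp[of "P q" m] sum_clamp[of "P q + w q" m] show ?thesis
      by (simp add: lo_def hi_def g_def sum_subtractf)
  qed
  moreover have "disjoint_family_on (\<lambda>q. {lo q k..<hi q k}) Q" for k
  proof -
    have "False" if "q \<in> Q" "r \<in> Q" "q \<noteq> r" and \<theta>: "\<theta> \<in> {lo q k..<hi q k}" "\<theta> \<in> {lo r k..<hi r k}"
      for q r \<theta>
      using P(3)[OF that(1-3)] iv[OF \<theta>(1)] iv[OF \<theta>(2)] by linarith
    then show ?thesis unfolding disjoint_family_on_def by blast
  qed
  moreover have "disjoint_family (\<lambda>k. {lo q k..<hi q k})" if "q \<in> Q" for q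
  proof -
    have "False" if "k \<noteq> l" and \<theta>: "\<theta> \<in> {lo q k..<hi q k}" "\<theta> \<in> {lo q l..<hi q l}" for k l \<theta>
    proof -
      have "\<bar>real k - real l\<bar> < 1"
        using iv[OF \<theta>(1)] iv[OF \<theta>(2)] w[OF \<open>q \<in> Q\<close>] by linarith
      with \<open>k \<noteq> l\<close> show False by linarith
    qed
    then show ?thesis unfolding disjoint_family_on_def by blast
  qed
  ultimately have "wrap_split Q m w lo hi" unfolding wrap_split_def by blast
  then show ?thesis by blast
qed

section \<open>The major grid\<close>

lemma tau_less:
  assumes "\<mu> < \<nu>" "\<nu> \<le> grid_N S"
  shows "tau S \<mu> < tau S \<nu>"
  using assms N_less[of S] by (intro tau_strict_mono) auto

lemma tau_mono:
  assumes "\<mu> \<le> \<nu>" "\<nu> \<le> grid_N S"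
  shows "tau S \<mu> \<le> tau S \<nu>"
  using assms tau_less[of \<mu> \<nu> S] by (cases "\<mu> = \<nu>") auto

lemma hyperperiod_pos: "rt_setting S \<Longrightarrow> 0 < hyperperiod S"
  using hyperperiod_least(1) by (simp add: common_multiple_def)

lemma tau_le_hyperperiod: "\<mu> \<le> grid_N S \<Longrightarrow> tau S \<mu> \<le> hyperperiod S"
  using tau_mono[of \<mu> "grid_N S" S] by (simp add: tau_N)

lemma tau_nonneg:
  assumes "rt_setting S" "\<mu> \<le> grid_N S"
  shows "0 \<le> tau S \<mu>"
  using tau_mono[of 0 \<mu> S] assms by (simp add: tau_0)

lemma grid_N_pos:
  assumes "rt_setting S"
  shows "0 < grid_N S"
  using tau_0[OF assms] hyperperiod_pos[OF assms] tau_N[of S] by (cases "grid_N S") auto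

lemma jobs_arrival_le:
  assumes "rt_setting S" "i \<in> tasks S" "j \<in> jobs S i"
  shows "0 \<le> arrival S i j" "arrival S i j \<le> hyperperiod S"
proof -
  have p: "period S i > 0" and L: "0 < hyperperiod S"
    using assms hyperperiod_pos by (auto simp: rt_setting_def)
  have j: "1 \<le> j" "j \<le> nat \<lfloor>hyperperiod S / period S i\<rfloor>"
    using assms(3) by (auto simp: jobs_def)
  have "real (nat \<lfloor>hyperperiod S / period S i\<rfloor>) \<le> hyperperiod S / period S i"
    using p L by (intro of_nat_floor) simp
  with j(2) have "real j \<le> hyperperiod S / period S i"
    by (meson of_nat_mono order_trans)
  then have "real j * period S i \<le> hyperperiod S" using p by (simp add: field_simps)
  then show "arrival S i j \<le> hyperperiod S" using p by (simp add: arrival_def algebra_simps)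
  show "0 \<le> arrival S i j" using p j by (simp add: arrival_def)
qed

lemma Phi_A_le:
  assumes "rt_setting S" "i \<in> tasks S" "j \<in> jobs S i"
  shows "Phi_A S i j \<le> grid_N S"
proof (rule ccontr)
  assume "\<not> ?thesis"
  moreover have "Phi_A S i j < card (event_times S)"
    unfolding Phi_A_def using assms by (intro grid_index) (auto simp: event_times_def)
  ultimately have "tau S (grid_N S) < tau S (Phi_A S i j)" by (intro tau_strict_mono) auto
  then show False
    using jobs_arrival_le[OF assms] tau_Phi(1)[OF assms(2,3)] by (simp add: tau_N)
qed

text \<open>Unlike arrivals, deadlines can exceed \<open>L\<close> when \<open>d_i > p_i\<close>,
  hence the extra hypothesis.\<close>

lemma Phi_D_le:
  assumes "i \<in> tasks S" "j \<in> jobs S i" "job_deadline S i j \<le> hyperperiod S"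
  shows "Phi_D S i j \<le> grid_N S"
proof (rule ccontr)
  assume "\<not> ?thesis"
  moreover have "Phi_D S i j < card (event_times S)"
    unfolding Phi_D_def using assms by (intro grid_index) (auto simp: event_times_def)
  ultimately have "tau S (grid_N S) < tau S (Phi_D S i j)" by (intro tau_strict_mono) auto
  then show False
    using assms tau_Phi(2)[OF assms(1,2)] by (simp add: tau_N)
qed

lemma finite_tasks [simp]: "finite (tasks S)" and finite_jobs [simp]: "finite (jobs S i)"
  and finite_procs [simp]: "finite (procs S)"
  by (simp_all add: tasks_def jobs_def procs_def)

section \<open>Locating a time in its grid cell\<close>

lemma grid_cell_exists:
  assumes S: "rt_setting S" and t: "0 \<le> t" "t < hyperperiod S"
  obtains \<mu> where "\<mu> < grid_N S" "t \<in> {tau S \<mu>..<tau S (\<mu> + 1)}"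
proof -
  define n where "n = (LEAST n. t < tau S n)"
  have "t < tau S (grid_N S)" using t(2) by (simp add: tau_N)
  then have n: "t < tau S n" "n \<le> grid_N S"
    unfolding n_def by (auto intro: LeastI Least_le)
  have "n \<noteq> 0" using n(1) t(1) tau_0[OF S] by (intro notI) simp
  then obtain \<mu> where \<mu>: "n = Suc \<mu>" by (cases n) auto
  have "\<not> t < tau S \<mu>" using \<mu> not_less_Least[of \<mu> "\<lambda>n. t < tau S n"] by (simp add: n_def)
  with n \<mu> show thesis by (intro that[of \<mu>]) auto
qed

text \<open>Collapses a piecewise definition to its one active cell. \<open>J \<nu>\<close> may be a
  proper part of the cell, so speeds, activations, derivatives and costs are all covered.\<close>

lemma sum_cell_indicator:
  assumes \<mu>: "\<mu> < grid_N S" "t \<in> {tau S \<mu>..<tau S (\<mu> + 1)}"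
    and sub: "\<And>\<nu>. \<nu> < grid_N S \<Longrightarrow> J \<nu> \<subseteq> {tau S \<nu>..<tau S (\<nu> + 1)}"
  shows "(\<Sum>\<nu><grid_N S. f \<nu> * indicat_real (J \<nu>) t) = f \<mu> * indicat_real (J \<mu>) t"
proof -
  have zero: "indicat_real (J \<nu>) t = 0" if \<nu>: "\<nu> < grid_N S" "\<nu> \<noteq> \<mu>" for \<nu>
  proof -
    have "t \<notin> {tau S \<nu>..<tau S (\<nu> + 1)}"
      using \<mu> \<nu> tau_mono[of "\<nu> + 1" \<mu> S] tau_mono[of "\<mu> + 1" \<nu> S] by (cases "\<nu> < \<mu>") auto
    then show ?thesis using sub[OF \<nu>(1)] by (auto simp: indicator_def)
  qed
  have "(\<Sum>\<nu><grid_N S. f \<nu> * indicat_real (J \<nu>) t)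
      = f \<mu> * indicat_real (J \<mu>) t + (\<Sum>\<nu>\<in>{..<grid_N S} - {\<mu>}. f \<nu> * indicat_real (J \<nu>) t)"
    using \<mu>(1) by (intro sum.remove) auto
  also have "(\<Sum>\<nu>\<in>{..<grid_N S} - {\<mu>}. f \<nu> * indicat_real (J \<nu>) t) = 0"
    using zero by (intro sum.neutral) auto
  finally show ?thesis by simp
qed

section \<open>From schedules to the program\<close>

lemma feasible_C_imp_feasible_P:
  assumes S: "rt_setting S" and C: "feasible_C S x s a"
  shows "\<exists>x s a. feasible_P S x s a"
proof -
  let ?N = "grid_N S" and ?L = "hyperperiod S"
  define \<Delta> where "\<Delta> \<mu> = tau S (\<mu> + 1) - tau S \<mu>" for \<mu>
  define J where "J \<mu> = {tau S \<mu>..tau S (\<mu> + 1)}" for \<mu>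
  define f where "f i j t = (\<Sum>k\<in>procs S. s i j k t * a i j k t)" for i j t
  define b where "b i j t = (\<Sum>k\<in>procs S. a i j k t)" for i j t
  \<comment> \<open>\<open>B\<close> is the processor time a job receives in an interval,
    \<open>W\<close> the drop of its state; the program will use speed \<open>W / B\<close> and
    activation \<open>B / \<Delta>\<close>.\<close>
  define B where "B i j \<mu> = integral (J \<mu>) (b i j)" for i j \<mu>
  define W where "W i j \<mu> = x i j (tau S \<mu>) - x i j (tau S (\<mu> + 1))" for i j \<mu>
  have smin: "0 \<le> s_min S" using S by (simp add: rt_setting_def)
  have Cs: "s_min S \<le> s i j k t" "s i j k t \<le> 1"
    and Ca: "a i j k t \<in> {0,1}" "(\<Sum>k\<in>procs S. a i j k t) \<le> 1"
    if "i \<in> tasks S" "j \<in> jobs S i" "k \<in> procs S" "t \<in> {0..?L}" for i j k t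
    using C that by (simp_all add: feasible_C_def Let_def)
  have Cp: "(\<Sum>i\<in>tasks S. \<Sum>j\<in>jobs S i. a i j k t) \<le> 1"
    if "k \<in> procs S" "t \<in> {0..?L}" for k t
    using C that by (simp add: feasible_C_def Let_def)
  obtain k0 where k0: "k0 \<in> procs S" using S by (auto simp: rt_setting_def procs_def)
  have \<Delta>pos: "0 < \<Delta> \<mu>" if "\<mu> < ?N" for \<mu>
    using tau_less[of \<mu> "\<mu> + 1" S] that by (simp add: \<Delta>_def)
  have Jsub: "J \<mu> \<subseteq> {0..?L}" if "\<mu> < ?N" for \<mu>
    using tau_nonneg[OF S, of \<mu>] tau_le_hyperperiod[of "\<mu> + 1" S] that by (auto simp: J_def)
  have fW: "(f i j has_integral W i j \<mu>) (J \<mu>)"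
    if ij: "i \<in> tasks S" "j \<in> jobs S i" and \<mu>: "\<mu> < ?N" for i j \<mu>
  proof -
    have "AE t in lebesgue. t \<in> {0..?L} \<longrightarrow> (x i j has_real_derivative - f i j t) (at t)"
      using C ij by (simp add: feasible_C_def Let_def f_def)
    then obtain M where M: "negligible M"
      "\<And>t. t \<notin> M \<Longrightarrow> t \<in> {0..?L} \<Longrightarrow> (x i j has_real_derivative - f i j t) (at t)"
      unfolding eventually_ae_filter negligible_iff_null_sets by auto
    have "absolutely_continuous_on (J \<mu>) (x i j)"
      using C ij absolutely_continuous_on_subset[OF _ Jsub[OF \<mu>]]
      by (simp add: feasible_C_def Let_def)
    then have "((\<lambda>t. - f i j t) has_integral x i j (tau S (\<mu> + 1)) - x i j (tau S \<mu>)) (J \<mu>)"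
      unfolding J_def
    proof (rule absolutely_continuous_has_integral[OF _ _ M(1)])
      show "tau S \<mu> \<le> tau S (\<mu> + 1)" using \<Delta>pos[OF \<mu>] by (simp add: \<Delta>_def)
      show "(x i j has_real_derivative - f i j t) (at t within {tau S \<mu>..tau S (\<mu> + 1)})"
        if "t \<in> {tau S \<mu>..tau S (\<mu> + 1)} - M" for t
        using M(2)[of t] Jsub[OF \<mu>] that unfolding J_def
        by (blast intro: has_field_derivative_at_within)
    qed
    from has_integral_neg[OF this] show ?thesis by (simp add: W_def)
  qed
  have a_bounds: "0 \<le> a i j k t" 
    if "i \<in> tasks S" "j \<in> jobs S i" "k \<in> procs S" "t \<in> {0..?L}" for i j k t
    using Ca(1)[OF that] by auto
  \<comment> \<open>Integrating the last two inequalities places \<open>W\<close> between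
    \<open>s_min S * B\<close> and \<open>B\<close>, which is what the averaged speed needs.\<close>
  have pointwise: "0 \<le> b i j t" "b i j t \<le> 1" "s_min S * b i j t \<le> f i j t" "f i j t \<le> b i j t"
    if "i \<in> tasks S" "j \<in> jobs S i" "t \<in> {0..?L}" for i j t
  proof -
    show "0 \<le> b i j t" unfolding b_def using a_bounds that by (intro sum_nonneg) auto
    show "b i j t \<le> 1" unfolding b_def using Ca(2) k0 that by blast
    show "s_min S * b i j t \<le> f i j t"
      unfolding b_def f_def sum_distrib_left using a_bounds Cs that
      by (intro sum_mono mult_right_mono) auto
    show "f i j t \<le> b i j t"
      unfolding b_def f_def
    proof (rule sum_mono)
      fix k assume "k \<in> procs S"
      then show "s i j k t * a i j k t \<le> a i j k t"
        using mult_right_mono[OF Cs(2) a_bounds, of i j k t i j k t] that by simp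
    qed
  qed
  have b_int: "b i j integrable_on J \<mu>"
    if ij: "i \<in> tasks S" "j \<in> jobs S i" and \<mu>: "\<mu> < ?N" for i j \<mu>
  proof (rule measurable_bounded_by_integrable_imp_integrable_real)
    have "a i j k \<in> borel_measurable (lebesgue_on (J \<mu>))" if "k \<in> procs S" for k
    proof (rule measurable_restrict_mono[OF _ Jsub[OF \<mu>]])
      show "a i j k \<in> borel_measurable (lebesgue_on {0..?L})"
        using C ij that by (simp add: feasible_C_def Let_def)
    qed
    then show "b i j \<in> borel_measurable (lebesgue_on (J \<mu>))"
      unfolding b_def by (intro borel_measurable_sum) auto
    show "(\<lambda>_. 1::real) integrable_on J \<mu>"
      unfolding J_def by (rule integrable_const_ivl)
    show "\<bar>b i j t\<bar> \<le> 1" if "t \<in> J \<mu>" for t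
      using pointwise(1,2)[OF ij, of t] Jsub[OF \<mu>] that by auto
    show "J \<mu> \<in> sets lebesgue" by (simp add: J_def)
  qed
  then have bB: "(b i j has_integral B i j \<mu>) (J \<mu>)"
    if "i \<in> tasks S" "j \<in> jobs S i" "\<mu> < ?N" for i j \<mu>
    using that unfolding B_def by (blast intro: integrable_integral)
  have const: "((\<lambda>_. c) has_integral \<Delta> \<mu> * c) (J \<mu>)" if "\<mu> < ?N" for \<mu> and c :: real
    using has_integral_const_real[of c "tau S \<mu>" "tau S (\<mu> + 1)"] \<Delta>pos[OF that]
    by (simp add: J_def \<Delta>_def)
  have B0: "0 \<le> B i j \<mu>" and B1: "B i j \<mu> \<le> \<Delta> \<mu>"
    and BW: "s_min S * B i j \<mu> \<le> W i j \<mu>" and WB: "W i j \<mu> \<le> B i j \<mu>"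
    if ij: "i \<in> tasks S" "j \<in> jobs S i" and \<mu>: "\<mu> < ?N" for i j \<mu>
  proof -
    note pw = pointwise[OF ij subsetD[OF Jsub[OF \<mu>]]]
    show "0 \<le> B i j \<mu>"
      using has_integral_le[OF const[OF \<mu>, of 0] bB[OF that]] pw by simp
    show "B i j \<mu> \<le> \<Delta> \<mu>"
      using has_integral_le[OF bB[OF that] const[OF \<mu>, of 1]] pw by simp
    show "W i j \<mu> \<le> B i j \<mu>"
      using has_integral_le[OF fW[OF that] bB[OF that]] pw by simp
    show "s_min S * B i j \<mu> \<le> W i j \<mu>"
      using has_integral_le[OF has_integral_mult_right[OF bB[OF that]] fW[OF that]] pw by simp
  qed
  \<comment> \<open>At each moment every processor serves at most one job, so exchanging the sums
    bounds the number of active jobs by the number of processors.\<close>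
  have Bsum: "(\<Sum>i\<in>tasks S. \<Sum>j\<in>jobs S i. B i j \<mu>) \<le> real (num_procs S) * \<Delta> \<mu>"
    if \<mu>: "\<mu> < ?N" for \<mu>
  proof -
    have "((\<lambda>t. \<Sum>i\<in>tasks S. \<Sum>j\<in>jobs S i. b i j t) has_integral
        (\<Sum>i\<in>tasks S. \<Sum>j\<in>jobs S i. B i j \<mu>)) (J \<mu>)"
      using bB \<mu> by (intro has_integral_sum) auto
    then have "(\<Sum>i\<in>tasks S. \<Sum>j\<in>jobs S i. B i j \<mu>) \<le> \<Delta> \<mu> * real (num_procs S)"
    proof (rule has_integral_le[OF _ const[OF \<mu>]])
      fix t assume t: "t \<in> J \<mu>"
      have "(\<Sum>i\<in>tasks S. \<Sum>j\<in>jobs S i. b i j t)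
          = (\<Sum>i\<in>tasks S. \<Sum>k\<in>procs S. \<Sum>j\<in>jobs S i. a i j k t)"
        unfolding b_def by (intro sum.cong refl sum.swap)
      also have "\<dots> = (\<Sum>k\<in>procs S. \<Sum>i\<in>tasks S. \<Sum>j\<in>jobs S i. a i j k t)"
        by (rule sum.swap)
      also have "\<dots> \<le> (\<Sum>k\<in>procs S. 1)"
        using Cp Jsub[OF \<mu>] t by (intro sum_mono) auto
      also have "\<dots> = real (num_procs S)" by (simp add: procs_def)
      finally show "(\<Sum>i\<in>tasks S. \<Sum>j\<in>jobs S i. b i j t) \<le> real (num_procs S)" .
    qed
    then show ?thesis by (simp add: mult.commute)
  qed
  \<comment> \<open>If \<open>B\<close> vanishes, so does \<open>W\<close>, and any admissible speed
    will do; \<open>s_min S\<close> is admissible because (C) itself forces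
    \<open>s_min S \<le> 1\<close>.\<close>
  define s' where "s' i j \<mu> = (if B i j \<mu> = 0 then s_min S else W i j \<mu> / B i j \<mu>)" for i j \<mu>
  define a' where "a' i j \<mu> = B i j \<mu> / \<Delta> \<mu>" for i j \<mu>
  have smin1: "s_min S \<le> 1" if "i \<in> tasks S" "j \<in> jobs S i" for i j
    using Cs[OF that k0, of 0] hyperperiod_pos[OF S] by simp
  have "feasible_P S (\<lambda>i j \<mu>. x i j (tau S \<mu>)) s' a'"
    unfolding feasible_P_def
  proof (intro conjI ballI allI impI)
    fix i j assume ij: "i \<in> tasks S" "j \<in> jobs S i"
    show "x i j (tau S (Phi_A S i j)) = min_exec_time S i" "x i j (tau S (Phi_D S i j)) = 0"
      using C ij by (simp_all add: feasible_C_def Let_def tau_Phi)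
    fix \<mu> assume \<mu>: "\<mu> < ?N"
    note ijm = ij \<mu>
    have W0: "W i j \<mu> = 0" if "B i j \<mu> = 0"
      using BW[OF ijm] WB[OF ijm] that by simp
    have "\<Delta> \<mu> * s' i j \<mu> * a' i j \<mu> = W i j \<mu>"
      using \<Delta>pos[OF \<mu>] W0 by (simp add: s'_def a'_def)
    then show "x i j (tau S (\<mu> + 1)) = x i j (tau S \<mu>) - (tau S (\<mu> + 1) - tau S \<mu>) * s' i j \<mu> * a' i j \<mu>"
      by (simp add: W_def \<Delta>_def)
    show "s_min S \<le> s' i j \<mu>"
      using BW[OF ijm] B0[OF ijm] by (simp add: s'_def pos_le_divide_eq)
    show "s' i j \<mu> \<le> 1"
      using WB[OF ijm] B0[OF ijm] smin1[OF ij] by (simp add: s'_def pos_divide_le_eq)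
    show "0 \<le> a' i j \<mu>" "a' i j \<mu> \<le> 1"
      using B0[OF ijm] B1[OF ijm] \<Delta>pos[OF \<mu>] by (simp_all add: a'_def)
  next
    fix \<mu> assume \<mu>: "\<mu> < ?N"
    show "(\<Sum>i\<in>tasks S. \<Sum>j\<in>jobs S i. a' i j \<mu>) \<le> real (num_procs S)"
      using Bsum[OF \<mu>] \<Delta>pos[OF \<mu>]
      by (simp add: a'_def pos_divide_le_eq flip: sum_divide_distrib)
  qed
  then show ?thesis by blast
qed

section \<open>Existence of an optimum\<close>

text \<open>The index guards in \<open>feasible_P\<close> do not depend on the variables, so
  closedness can be proved along the syntax of the constraints.\<close>

lemma closed_Collect_const_imp:
  assumes "P \<Longrightarrow> closed {z. R z}"
  shows "closed {z. P \<longrightarrow> R z}"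
  using assms by (cases P) auto

text \<open>The state is determined by speeds and activations, so the program can be minimised over
  those alone.\<close>
definition traj :: "rt_system \<Rightarrow> (nat \<Rightarrow> nat \<Rightarrow> nat \<Rightarrow> real) \<Rightarrow> (nat \<Rightarrow> nat \<Rightarrow> nat \<Rightarrow> real) \<Rightarrow>
    nat \<Rightarrow> nat \<Rightarrow> nat \<Rightarrow> real" where
  "traj S s a i j \<mu> =
     (if \<mu> \<le> grid_N S
      then min_exec_time S i
        + (\<Sum>\<nu><Phi_A S i j. (tau S (\<nu> + 1) - tau S \<nu>) * s i j \<nu> * a i j \<nu>)
        - (\<Sum>\<nu><\<mu>. (tau S (\<nu> + 1) - tau S \<nu>) * s i j \<nu> * a i j \<nu>)
      else 0)"

lemma feasible_P_state:
  assumes "feasible_P S x s a" "i \<in> tasks S" "j \<in> jobs S i" "\<mu> \<le> grid_N S"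
  shows "x i j \<mu> = x i j 0 - (\<Sum>\<nu><\<mu>. (tau S (\<nu> + 1) - tau S \<nu>) * s i j \<nu> * a i j \<nu>)"
  using assms(4)
proof (induction \<mu>)
  case (Suc \<mu>)
  then show ?case using assms(1-3) by (simp add: feasible_P_def)
qed simp

text \<open>The recurrence and the arrival value force the state up to \<open>grid_N S\<close>.
  Later indices are met only by deadline conditions, which the default 0 of \<open>traj\<close>
  satisfies.\<close>

lemma feasible_P_traj:
  assumes S: "rt_setting S" and P: "feasible_P S x s a"
  shows "feasible_P S (traj S s a) s a"
proof -
  have eq: "traj S s a i j \<mu> = x i j \<mu>"
    if ij: "i \<in> tasks S" "j \<in> jobs S i" and \<mu>: "\<mu> \<le> grid_N S" for i j \<mu>
  proof -
    have "x i j (Phi_A S i j) = min_exec_time S i" using P ij by (simp add: feasible_P_def)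
    then show ?thesis
      using feasible_P_state[OF P ij \<mu>] feasible_P_state[OF P ij Phi_A_le[OF S ij]] \<mu>
      by (simp add: traj_def)
  qed
  have "traj S s a i j (Phi_D S i j) = 0" if ij: "i \<in> tasks S" "j \<in> jobs S i" for i j
    using eq[OF ij, of "Phi_D S i j"] P ij
    by (cases "Phi_D S i j \<le> grid_N S") (auto simp: feasible_P_def traj_def)
  then show ?thesis
    using P eq Phi_A_le[OF S] by (simp add: feasible_P_def)
qed

lemma feasible_P_cong:
  assumes "\<And>i j \<mu>. \<lbrakk>i \<in> tasks S; j \<in> jobs S i; \<mu> < grid_N S\<rbrakk> \<Longrightarrow> s i j \<mu> = s' i j \<mu> \<and> a i j \<mu> = a' i j \<mu>"
  shows "feasible_P S x s a \<longleftrightarrow> feasible_P S x s' a'"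
proof -
  have "(\<Sum>i\<in>tasks S. \<Sum>j\<in>jobs S i. a i j \<mu>) = (\<Sum>i\<in>tasks S. \<Sum>j\<in>jobs S i. a' i j \<mu>)"
    if "\<mu> < grid_N S" for \<mu>
    using assms that by (intro sum.cong refl) simp
  then show ?thesis
    using assms unfolding feasible_P_def by simp
qed

lemma cost_P_cong:
  assumes "\<And>i j \<mu>. \<lbrakk>i \<in> tasks S; j \<in> jobs S i; \<mu> < grid_N S\<rbrakk> \<Longrightarrow> s i j \<mu> = s' i j \<mu> \<and> a i j \<mu> = a' i j \<mu>"
  shows "cost_P S s a = cost_P S s' a'"
  unfolding cost_P_def using assms by (intro sum.cong refl) simp

lemma optimal_P_exists:
  assumes S: "rt_setting S" and ex: "feasible_P S x0 s0 a0"
  shows "\<exists>x s a. optimal_P S x s a"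
proof -
  let ?N = "grid_N S"
  define sp :: "(nat \<times> nat \<times> nat \<Rightarrow> real \<times> real) \<Rightarrow> nat \<Rightarrow> nat \<Rightarrow> nat \<Rightarrow> real"
    where "sp z i j \<mu> = fst (z (i, j, \<mu>))" for z i j \<mu>
  define ac :: "(nat \<times> nat \<times> nat \<Rightarrow> real \<times> real) \<Rightarrow> nat \<Rightarrow> nat \<Rightarrow> nat \<Rightarrow> real"
    where "ac z i j \<mu> = snd (z (i, j, \<mu>))" for z i j \<mu>
  \<comment> \<open>The box ranges over all index triples, relevant or not, so its compactness is
    Tychonoff's theorem in the product topology.\<close>
  define K :: "(nat \<times> nat \<times> nat \<Rightarrow> real \<times> real) set"
    where "K = PiE UNIV (\<lambda>_. {s_min S..1} \<times> {0..1})"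
  define F where "F = K \<inter> {z. feasible_P S (traj S (sp z) (ac z)) (sp z) (ac z)}"
  have smin: "0 \<le> s_min S" and \<beta>: "0 < p_beta S" using S by (simp_all add: rt_setting_def)
  have cont_sp [continuous_intros]: "continuous_on A (\<lambda>z. sp z i j \<mu>)" for A i j \<mu>
    unfolding sp_def
    by (rule continuous_on_fst[OF continuous_on_product_then_coordinatewise[OF continuous_on_id]])
  have cont_ac [continuous_intros]: "continuous_on A (\<lambda>z. ac z i j \<mu>)" for A i j \<mu>
    unfolding ac_def
    by (rule continuous_on_snd[OF continuous_on_product_then_coordinatewise[OF continuous_on_id]])
  have cont_traj [continuous_intros]: "continuous_on A (\<lambda>z. traj S (sp z) (ac z) i j \<mu>)" for A i j \<mu>
    by (cases "\<mu> \<le> ?N") (auto simp: traj_def intro!: continuous_intros)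
  have "compactin (product_topology (\<lambda>_. euclidean) UNIV) K"
    unfolding K_def compactin_PiE by (auto intro!: compact_Times)
  then have "compact K" by (simp add: euclidean_product_topology)
  moreover have "closed {z. feasible_P S (traj S (sp z) (ac z)) (sp z) (ac z)}"
    unfolding feasible_P_def Ball_def
    by (intro closed_Collect_conj closed_Collect_all closed_Collect_const_imp
        closed_Collect_eq closed_Collect_le continuous_intros)
  ultimately have compact: "compact F" unfolding F_def by (rule compact_Int_closed)
  have one: "1 \<in> tasks S" using S by (simp add: rt_setting_def tasks_def)
  moreover have "1 \<in> jobs S 1"
  proof -
    have p: "period S 1 > 0" using S one by (simp add: rt_setting_def)
    obtain q where q: "hyperperiod S = real q * period S 1"
      using hyperperiod_least(1)[OF S] one by (auto simp: common_multiple_def)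
    then have "q \<ge> 1" using hyperperiod_pos[OF S] by (cases q) auto
    with q p show ?thesis by (simp add: jobs_def)
  qed
  ultimately have smin1: "s_min S \<le> 1"
    using ex grid_N_pos[OF S] unfolding feasible_P_def by (meson order_trans)
  have retract: "\<exists>z\<in>F. cost_P S (sp z) (ac z) = cost_P S s a" if P: "feasible_P S x s a" for x s a
  proof -
    define R where "R i j \<mu> \<longleftrightarrow> i \<in> tasks S \<and> j \<in> jobs S i \<and> \<mu> < ?N" for i j \<mu>
    define z where "z = (\<lambda>(i, j, \<mu>). if R i j \<mu> then (s i j \<mu>, a i j \<mu>) else (s_min S, 0))"
    have agree: "s i j \<mu> = sp z i j \<mu> \<and> a i j \<mu> = ac z i j \<mu>"
      if "i \<in> tasks S" "j \<in> jobs S i" "\<mu> < ?N" for i j \<mu>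
      using that by (simp add: sp_def ac_def z_def R_def)
    have "z (i, j, \<mu>) \<in> {s_min S..1} \<times> {0..1}" for i j \<mu>
      using P smin1 by (simp add: z_def R_def feasible_P_def)
    then have "z \<in> K" by (auto simp: K_def PiE_iff)
    moreover have "feasible_P S x (sp z) (ac z)"
      using feasible_P_cong[of S s "sp z" a "ac z" x] agree P by blast
    ultimately have "z \<in> F" unfolding F_def using feasible_P_traj[OF S] by blast
    moreover have "cost_P S (sp z) (ac z) = cost_P S s a"
      using cost_P_cong[of S s "sp z" a "ac z"] agree by simp
    ultimately show ?thesis by blast
  qed
  \<comment> \<open>\<open>s_min S\<close> may be 0, and continuity of \<open>powr\<close> at base 0
    requires a nonnegative base and a positive exponent.\<close>
  have cont_powr: "continuous_on F (\<lambda>z. sp z i j \<mu> powr p_beta S)" for i j \<mu>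
  proof (intro continuous_on_powr' cont_sp continuous_on_const ballI conjI impI)
    fix z assume "z \<in> F"
    then have "z (i, j, \<mu>) \<in> {s_min S..1} \<times> {0..1}"
      unfolding F_def K_def by (blast dest: PiE_mem)
    then show "0 \<le> sp z i j \<mu>" using smin by (auto simp: sp_def)
  qed (rule \<beta>)
  have "F \<noteq> {}" using retract[OF ex] by blast
  moreover have "continuous_on F (\<lambda>z. cost_P S (sp z) (ac z))"
    unfolding cost_P_def stage_cost_def power_active_def
    by (intro continuous_on_sum continuous_on_mult continuous_on_add continuous_on_diff
        continuous_on_const cont_ac cont_powr)
  ultimately obtain z where z: "z \<in> F"
    "\<And>y. y \<in> F \<Longrightarrow> cost_P S (sp z) (ac z) \<le> cost_P S (sp y) (ac y)"
    using continuous_attains_inf[OF compact] by blast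
  have "optimal_P S (traj S (sp z) (ac z)) (sp z) (ac z)"
    unfolding optimal_P_def
  proof (intro conjI allI impI)
    show "feasible_P S (traj S (sp z) (ac z)) (sp z) (ac z)" using z(1) by (simp add: F_def)
    show "cost_P S (sp z) (ac z) \<le> cost_P S s a" if "feasible_P S x s a" for x s a
      using retract[OF that] z(2) by fastforce
  qed
  then show ?thesis by blast
qed

section \<open>From the program to schedules\<close>

lemma schedule_from_feasible_P:
  assumes S: "rt_setting S" and P: "feasible_P S x s a"
  shows "\<exists>x' s' a'. feasible_C S x' s' a' \<and> energy_C S s' a' = cost_P S s a"
proof -
  let ?N = "grid_N S" and ?L = "hyperperiod S" and ?\<tau> = "tau S" and ?m = "num_procs S"
  define \<Delta> where "\<Delta> \<mu> = ?\<tau> (\<mu> + 1) - ?\<tau> \<mu>" for \<mu>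
  define Q where "Q = (SIGMA i:tasks S. jobs S i)"
  have finQ: "finite Q" by (simp add: Q_def)
  have "\<exists>lo hi. wrap_split Q ?m (\<lambda>q. a (fst q) (snd q) \<mu>) lo hi" if \<mu>: "\<mu> < ?N" for \<mu>
  proof (rule wrap_around[OF finQ])
    show "sum (\<lambda>q. a (fst q) (snd q) \<mu>) Q \<le> real ?m"
      using P \<mu> by (simp add: Q_def feasible_P_def sum.Sigma split_def)
    show "0 \<le> a (fst q) (snd q) \<mu> \<and> a (fst q) (snd q) \<mu> \<le> 1" if "q \<in> Q" for q
      using P \<mu> that by (auto simp: Q_def feasible_P_def)
  qed
  then obtain lo hi where
    wrap: "\<And>\<mu>. \<mu> < ?N \<Longrightarrow> wrap_split Q ?m (\<lambda>q. a (fst q) (snd q) \<mu>) (lo \<mu>) (hi \<mu>)"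
    by metis
  \<comment> \<open>The unit-interval pattern of the wrap-around rule is stretched affinely onto the
    grid cell.\<close>
  define l where "l i j k \<mu> = ?\<tau> \<mu> + \<Delta> \<mu> * lo \<mu> (i, j) k" for i j k \<mu>
  define h where "h i j k \<mu> = ?\<tau> \<mu> + \<Delta> \<mu> * hi \<mu> (i, j) k" for i j k \<mu>
  define J where "J i j k \<mu> = {l i j k \<mu>..<h i j k \<mu>}" for i j k \<mu>
  \<comment> \<open>The factor 1 gives the sum the shape of
    \<open>sum_cell_indicator\<close>.\<close>
  define a' where "a' i j k t = (\<Sum>\<mu><?N. 1 * indicat_real (J i j k \<mu>) t)" for i j k t
  \<comment> \<open>No half-open cell contains \<open>L\<close>, yet the speed bounds apply there
    too; the extra term supplies an admissible value.\<close>
  define s' where "s' i j k t =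
      (\<Sum>\<mu><?N. s i j \<mu> * indicat_real {?\<tau> \<mu>..<?\<tau> (\<mu> + 1)} t) + s i j 0 * indicat_real {?L} t"
    for i j and k :: nat and t
  define X where "X i j t = x i j 0 - (\<Sum>\<mu><?N. \<Sum>k\<in>procs S. s i j \<mu> * ramp (l i j k \<mu>) (h i j k \<mu>) t)"
    for i j t
  \<comment> \<open>Deadlines beyond \<open>L\<close> must find the value 0. The possible jump just
    after \<open>L\<close> is harmless: absolute continuity is required on \<open>[0, L]\<close>
    only.\<close>
  define x' where "x' i j t = (if t \<le> ?L then X i j t else 0)" for i j t
  have \<Delta>pos: "0 < \<Delta> \<mu>" if "\<mu> < ?N" for \<mu>
    using tau_less[of \<mu> "\<mu> + 1" S] that by (simp add: \<Delta>_def)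
  have Q: "(i, j) \<in> Q" if "i \<in> tasks S" "j \<in> jobs S i" for i j
    using that by (simp add: Q_def)
  have lh: "?\<tau> \<mu> \<le> l i j k \<mu>" "l i j k \<mu> \<le> h i j k \<mu>" "h i j k \<mu> \<le> ?\<tau> (\<mu> + 1)"
    if "i \<in> tasks S" "j \<in> jobs S i" "\<mu> < ?N" for i j k \<mu>
  proof -
    have 1: "0 \<le> lo \<mu> (i, j) k" "lo \<mu> (i, j) k \<le> hi \<mu> (i, j) k" "hi \<mu> (i, j) k \<le> 1"
      using wrap[OF that(3)] Q[OF that(1,2)] unfolding wrap_split_def by blast+
    note \<Delta> = less_imp_le[OF \<Delta>pos[OF that(3)]]
    show "?\<tau> \<mu> \<le> l i j k \<mu>" using 1(1) \<Delta> by (simp add: l_def)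
    show "l i j k \<mu> \<le> h i j k \<mu>" using mult_left_mono[OF 1(2) \<Delta>] by (simp add: l_def h_def)
    have "h i j k \<mu> \<le> ?\<tau> \<mu> + \<Delta> \<mu>"
      using mult_left_mono[OF 1(3) \<Delta>] by (simp add: h_def)
    then show "h i j k \<mu> \<le> ?\<tau> (\<mu> + 1)" by (simp add: \<Delta>_def)
  qed
  have Jsub: "J i j k \<mu> \<subseteq> {?\<tau> \<mu>..<?\<tau> (\<mu> + 1)}"
    if "i \<in> tasks S" "j \<in> jobs S i" "\<mu> < ?N" for i j k \<mu>
    using lh(1,3)[OF that] unfolding J_def by (rule ivl_subset[THEN iffD2, OF disjI2, OF conjI])
  \<comment> \<open>Work and energy both reduce to this total execution time over the
    processors.\<close>
  have Jlen: "(\<Sum>k\<in>procs S. h i j k \<mu> - l i j k \<mu>) = \<Delta> \<mu> * a i j \<mu>"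
    if "i \<in> tasks S" "j \<in> jobs S i" "\<mu> < ?N" for i j \<mu>
  proof -
    have "(\<Sum>k=1..?m. hi \<mu> (i, j) k - lo \<mu> (i, j) k) = a i j \<mu>"
      using wrap[OF that(3)] Q[OF that(1,2)] unfolding wrap_split_def by fastforce
    then have "\<Delta> \<mu> * a i j \<mu> = (\<Sum>k=1..?m. \<Delta> \<mu> * (hi \<mu> (i, j) k - lo \<mu> (i, j) k))"
      by (simp flip: sum_distrib_left)
    then show ?thesis by (simp add: l_def h_def procs_def right_diff_distrib)
  qed
  have J_iff: "t \<in> J i j k \<mu> \<longleftrightarrow>
      (t - ?\<tau> \<mu>) / \<Delta> \<mu> \<in> {lo \<mu> (i, j) k..<hi \<mu> (i, j) k}" if "\<mu> < ?N" for t i j k \<mu>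
    by (simp add: J_def l_def h_def pos_le_divide_eq[OF \<Delta>pos[OF that]]
        pos_divide_less_eq[OF \<Delta>pos[OF that]] mult.commute[of _ "\<Delta> \<mu>"] le_diff_eq diff_less_eq add.commute)
  have J_disj_k: "disjoint_family (\<lambda>k. J i j k \<mu>)"
    if "i \<in> tasks S" "j \<in> jobs S i" "\<mu> < ?N" for i j \<mu>
  proof -
    have "disjoint_family (\<lambda>k. {lo \<mu> (i, j) k..<hi \<mu> (i, j) k})"
      using wrap[OF that(3)] Q[OF that(1,2)] unfolding wrap_split_def by blast
    then show ?thesis
      using J_iff[OF that(3)] unfolding disjoint_family_on_def by blast
  qed
  have J_disj_q: "disjoint_family_on (\<lambda>q. J (fst q) (snd q) k \<mu>) Q" if "\<mu> < ?N" for k \<mu>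
  proof -
    have "disjoint_family_on (\<lambda>q. {lo \<mu> q k..<hi \<mu> q k}) Q"
      using wrap[OF that] unfolding wrap_split_def by blast
    moreover have "t \<in> J (fst q) (snd q) k \<mu> \<longleftrightarrow> (t - ?\<tau> \<mu>) / \<Delta> \<mu> \<in> {lo \<mu> q k..<hi \<mu> q k}" for t q
      using J_iff[OF that, of t "fst q" "snd q" k] by simp
    ultimately show ?thesis
      unfolding disjoint_family_on_def by blast
  qed
  have N0: "0 < ?N" by (rule grid_N_pos[OF S])
  have a_cell: "a' i j k t = indicat_real (J i j k \<mu>) t"
    if "i \<in> tasks S" "j \<in> jobs S i" "\<mu> < ?N" "t \<in> {?\<tau> \<mu>..<?\<tau> (\<mu> + 1)}" for i j k \<mu> t
    unfolding a'_def using sum_cell_indicator[OF that(3,4) Jsub[OF that(1,2)], where f = "\<lambda>_. 1"] by simp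
  have notL: "t < ?L" if "\<mu> < ?N" "t < ?\<tau> (\<mu> + 1)" for t \<mu>
    using that tau_le_hyperperiod[of "\<mu> + 1" S] by simp
  have s_cell: "s' i j k t = s i j \<mu>" if "\<mu> < ?N" "t \<in> {?\<tau> \<mu>..<?\<tau> (\<mu> + 1)}" for i j k \<mu> t
    unfolding s'_def
    using sum_cell_indicator[OF that, of "\<lambda>\<nu>. {?\<tau> \<nu>..<?\<tau> (\<nu> + 1)}" "s i j"] that notL[OF that(1), of t]
    by simp
  have a_L: "a' i j k ?L = 0" if "i \<in> tasks S" "j \<in> jobs S i" for i j k
    unfolding a'_def
  proof (rule sum.neutral, rule ballI)
    fix \<mu> assume "\<mu> \<in> {..<?N}"
    then have "\<mu> < ?N" by simp
    then have "?L \<notin> J i j k \<mu>" using Jsub[OF that, of \<mu> k] notL[of \<mu> ?L] by auto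
    then show "1 * indicat_real (J i j k \<mu>) ?L = 0" by simp
  qed
  have s_L: "s' i j k ?L = s i j 0" for i j k
  proof -
    have "?L \<notin> {?\<tau> \<mu>..<?\<tau> (\<mu> + 1)}" if "\<mu> < ?N" for \<mu>
      using notL[OF that, of ?L] by auto
    then have "(\<Sum>\<mu><?N. s i j \<mu> * indicat_real {?\<tau> \<mu>..<?\<tau> (\<mu> + 1)} ?L) = 0"
      by (intro sum.neutral ballI) simp
    then show ?thesis by (simp add: s'_def)
  qed
  have cells: "t = ?L \<or> (\<exists>\<mu><?N. t \<in> {?\<tau> \<mu>..<?\<tau> (\<mu> + 1)})" if "t \<in> {0..?L}" for t
  proof (cases "t = ?L")
    case False
    with that have "0 \<le> t" "t < ?L" by auto
    then obtain \<mu> where "\<mu> < ?N" "t \<in> {?\<tau> \<mu>..<?\<tau> (\<mu> + 1)}"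
      by (rule grid_cell_exists[OF S])
    then show ?thesis by blast
  qed simp
  \<comment> \<open>At a grid point the ramps of earlier cells are saturated and those of later
    cells have not started, so the recurrence of the program reappears.\<close>
  have X_tau: "X i j (?\<tau> \<mu>) = x i j \<mu>"
    if ij: "i \<in> tasks S" "j \<in> jobs S i" and \<mu>: "\<mu> \<le> ?N" for i j \<mu>
  proof -
    have early: "(\<Sum>k\<in>procs S. s i j \<nu> * ramp (l i j k \<nu>) (h i j k \<nu>) (?\<tau> \<mu>)) = \<Delta> \<nu> * s i j \<nu> * a i j \<nu>"
      if \<nu>: "\<nu> < \<mu>" for \<nu>
    proof -
      have \<nu>N: "\<nu> < ?N" using \<nu> \<mu> by simp
      have "ramp (l i j k \<nu>) (h i j k \<nu>) (?\<tau> \<mu>) = h i j k \<nu> - l i j k \<nu>" for k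
        using lh[OF ij \<nu>N, of k] tau_mono[of "\<nu> + 1" \<mu> S] \<nu> \<mu> by (simp add: ramp_def)
      then show ?thesis using Jlen[OF ij \<nu>N] by (simp flip: sum_distrib_left)
    qed
    have late: "(\<Sum>k\<in>procs S. s i j \<nu> * ramp (l i j k \<nu>) (h i j k \<nu>) (?\<tau> \<mu>)) = 0"
      if \<nu>: "\<nu> \<in> {..<?N} - {..<\<mu>}" for \<nu>
    proof -
      have "ramp (l i j k \<nu>) (h i j k \<nu>) (?\<tau> \<mu>) = 0" for k
        using lh[OF ij, of \<nu> k] tau_mono[of \<mu> \<nu> S] \<nu> by (simp add: ramp_def)
      then show ?thesis by simp
    qed
    have "(\<Sum>\<nu><?N. \<Sum>k\<in>procs S. s i j \<nu> * ramp (l i j k \<nu>) (h i j k \<nu>) (?\<tau> \<mu>))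
        = (\<Sum>\<nu><\<mu>. \<Sum>k\<in>procs S. s i j \<nu> * ramp (l i j k \<nu>) (h i j k \<nu>) (?\<tau> \<mu>))"
      using \<mu> late by (intro sum.mono_neutral_right) auto
    also have "\<dots> = (\<Sum>\<nu><\<mu>. \<Delta> \<nu> * s i j \<nu> * a i j \<nu>)"
      using early by (intro sum.cong) auto
    finally show ?thesis
      using feasible_P_state[OF P ij \<mu>] by (simp add: X_def \<Delta>_def)
  qed
  have X_lip: "\<bar>X i j u - X i j v\<bar> \<le> (\<Sum>q\<in>{..<?N} \<times> procs S. \<bar>s i j (fst q)\<bar>) * \<bar>u - v\<bar>"
    for i j u v
  proof -
    define Y where "Y t = (\<Sum>q\<in>{..<?N} \<times> procs S.
        s i j (fst q) * ramp (l i j (snd q) (fst q)) (h i j (snd q) (fst q)) t)" for t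
    have "X i j t = x i j 0 - Y t" for t
      by (simp only: X_def Y_def sum.cartesian_product split_def)
    then have "X i j u - X i j v = - (Y u - Y v)" by simp
    then have "\<bar>X i j u - X i j v\<bar> = \<bar>Y u - Y v\<bar>" by (simp only: abs_minus_cancel)
    moreover have "\<bar>Y u - Y v\<bar> \<le> (\<Sum>q\<in>{..<?N} \<times> procs S. \<bar>s i j (fst q)\<bar>) * \<bar>u - v\<bar>"
      unfolding Y_def by (rule sum_ramp_lipschitz)
    ultimately show ?thesis by (simp only:)
  qed
  have X_deriv: "AE t in lebesgue. t \<in> {0..?L} \<longrightarrow>
      (x' i j has_real_derivative - (\<Sum>k\<in>procs S. s' i j k t * a' i j k t)) (at t)"
    if ij: "i \<in> tasks S" "j \<in> jobs S i" for i j
  proof -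
    \<comment> \<open>Besides the kinks of the ramps, \<open>L\<close> is excluded because the
      derivative is two-sided and \<open>x'\<close> may jump there.\<close>
    define E where "E = insert ?L ((\<lambda>(k, \<mu>). l i j k \<mu>) ` (procs S \<times> {..<?N}) \<union>
        (\<lambda>(k, \<mu>). h i j k \<mu>) ` (procs S \<times> {..<?N}))"
    have "finite E" by (simp add: E_def)
    then have "E \<in> null_sets lebesgue"
      using negligible_finite negligible_iff_null_sets by blast
    moreover have "(x' i j has_real_derivative - (\<Sum>k\<in>procs S. s' i j k t * a' i j k t)) (at t)"
      if t: "t \<in> {0..?L}" "t \<notin> E" for t
    proof -
      have tL: "t < ?L" using t by (auto simp: E_def)
      obtain \<mu> where \<mu>: "\<mu> < ?N" "t \<in> {?\<tau> \<mu>..<?\<tau> (\<mu> + 1)}"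
        using cells[OF t(1)] tL by (metis less_irrefl)
      have "(X i j has_real_derivative
          0 - (\<Sum>\<nu><?N. \<Sum>k\<in>procs S. s i j \<nu> * indicat_real (J i j k \<nu>) t)) (at t)"
        unfolding X_def J_def
      proof (intro DERIV_diff DERIV_const DERIV_sum DERIV_cmult ramp_has_real_derivative)
        fix \<nu> k assume "\<nu> \<in> {..<?N}" "k \<in> procs S"
        then show "l i j k \<nu> \<le> h i j k \<nu>" "t \<noteq> l i j k \<nu>" "t \<noteq> h i j k \<nu>"
          using lh(2)[OF ij] t(2) by (auto simp: E_def)
      qed
      also have "(\<Sum>\<nu><?N. \<Sum>k\<in>procs S. s i j \<nu> * indicat_real (J i j k \<nu>) t)
          = (\<Sum>k\<in>procs S. \<Sum>\<nu><?N. s i j \<nu> * indicat_real (J i j k \<nu>) t)"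
        by (rule sum.swap)
      also have "\<dots> = (\<Sum>k\<in>procs S. s' i j k t * a' i j k t)"
        using sum_cell_indicator[OF \<mu> Jsub[OF ij]] a_cell[OF ij \<mu>] s_cell[OF \<mu>] by simp
      finally have "(X i j has_real_derivative - (\<Sum>k\<in>procs S. s' i j k t * a' i j k t)) (at t)"
        by simp
      then show ?thesis
        by (rule has_field_derivative_transform_within_open[where S = "{..<?L}"])
          (use tL in \<open>auto simp: x'_def\<close>)
    qed
    ultimately show ?thesis by (intro AE_I'[of E]) auto
  qed
  have s_vals: "\<exists>\<mu><?N. s' i j k t = s i j \<mu>" if "t \<in> {0..?L}" for i j k t
    using cells[OF that]
  proof (elim disjE exE conjE)
    show ?thesis if "t = ?L" using s_L[of i j k] N0 that by blast
    show ?thesis if "\<mu> < ?N" "t \<in> {?\<tau> \<mu>..<?\<tau> (\<mu> + 1)}" for \<mu>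
      using s_cell[OF that, of i j k] that(1) by blast
  qed
  have "feasible_C S x' s' a'"
    unfolding feasible_C_def Let_def
  proof (intro conjI ballI)
    fix i j assume ij: "i \<in> tasks S" "j \<in> jobs S i"
    show "absolutely_continuous_on {0..?L} (x' i j)"
      by (rule lipschitz_imp_absolutely_continuous_on[of _ _ "\<Sum>q\<in>{..<?N} \<times> procs S. \<bar>s i j (fst q)\<bar>"])
        (use X_lip in \<open>simp add: x'_def\<close>)
    show "x' i j (arrival S i j) = min_exec_time S i"
      using jobs_arrival_le[OF S ij] X_tau[OF ij Phi_A_le[OF S ij]] tau_Phi(1)[OF ij] P ij
      by (simp add: x'_def feasible_P_def)
    show "x' i j (job_deadline S i j) = 0"
    proof (cases "job_deadline S i j \<le> ?L")
      case True
      then show ?thesis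
        using X_tau[OF ij Phi_D_le[OF ij True]] tau_Phi(2)[OF ij] P ij
        by (simp add: x'_def feasible_P_def)
    qed (simp add: x'_def)
    show "AE t in lebesgue. t \<in> {0..?L} \<longrightarrow>
        (x' i j has_real_derivative - (\<Sum>k\<in>procs S. s' i j k t * a' i j k t)) (at t)"
      by (rule X_deriv[OF ij])
    fix t assume t: "t \<in> {0..?L}"
    show "(\<Sum>k\<in>procs S. a' i j k t) \<le> 1"
      using cells[OF t]
    proof (elim disjE exE conjE)
      fix \<mu> assume \<mu>: "\<mu> < ?N" "t \<in> {?\<tau> \<mu>..<?\<tau> (\<mu> + 1)}"
      show ?thesis
        using sum_indicator_disjoint_le[OF finite_procs
            disjoint_family_on_mono[OF subset_UNIV J_disj_k[OF ij \<mu>(1)]]] a_cell[OF ij \<mu>]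
        by simp
    qed (simp add: a_L[OF ij])
  next
    fix i j k assume ij: "i \<in> tasks S" "j \<in> jobs S i"
    show "s' i j k \<in> borel_measurable (lebesgue_on {0..?L})"
      unfolding s'_def by (intro measurable_restrict_space1 measurable_completion) measurable
    show "a' i j k \<in> borel_measurable (lebesgue_on {0..?L})"
      unfolding a'_def J_def by (intro measurable_restrict_space1 measurable_completion) measurable
    fix t assume t: "t \<in> {0..?L}"
    show "s_min S \<le> s' i j k t" "s' i j k t \<le> 1"
      using s_vals[OF t, of i j k] P ij by (auto simp: feasible_P_def)
    show "a' i j k t \<in> {0, 1}"
      using cells[OF t]
    proof (elim disjE exE conjE)
      show ?thesis if "t = ?L" using a_L[OF ij, of k] that by simp
      show ?thesis if "\<mu> < ?N" "t \<in> {?\<tau> \<mu>..<?\<tau> (\<mu> + 1)}" for \<mu>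
        using a_cell[OF ij that, of k] by (simp add: indicator_def)
    qed
  next
    fix k t assume t: "t \<in> {0..?L}"
    have "(\<Sum>i\<in>tasks S. \<Sum>j\<in>jobs S i. a' i j k t) = (\<Sum>q\<in>Q. a' (fst q) (snd q) k t)"
      unfolding Q_def by (simp add: sum.Sigma split_def)
    also have "\<dots> \<le> 1"
      using cells[OF t]
    proof (elim disjE exE conjE)
      assume "t = ?L"
      then have "(\<Sum>q\<in>Q. a' (fst q) (snd q) k t) = 0"
        using a_L by (intro sum.neutral) (auto simp: Q_def)
      then show ?thesis by simp
    next
      fix \<mu> assume \<mu>: "\<mu> < ?N" "t \<in> {?\<tau> \<mu>..<?\<tau> (\<mu> + 1)}"
      have "(\<Sum>q\<in>Q. a' (fst q) (snd q) k t) = (\<Sum>q\<in>Q. indicat_real (J (fst q) (snd q) k \<mu>) t)"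
        using a_cell[OF _ _ \<mu>] by (intro sum.cong) (auto simp: Q_def)
      then show ?thesis
        using sum_indicator_disjoint_le[OF finQ J_disj_q[OF \<mu>(1)]] by simp
    qed
    finally show "(\<Sum>i\<in>tasks S. \<Sum>j\<in>jobs S i. a' i j k t) \<le> 1" .
  qed
  moreover have "energy_C S s' a' = cost_P S s a"
  proof -
    define c where "c i j \<mu> = power_active S (s i j \<mu>) - p_idle S" for i j \<mu>
    \<comment> \<open>Inside a cell the speed is constant, and the cost vanishes while the job is
      idle; what remains is the constant rate \<open>c\<close> on each execution interval.\<close>
    have stage_integral: "integral {0..?L} (\<lambda>t. stage_cost S (a' i j k t) (s' i j k t))
        = (\<Sum>\<mu><?N. c i j \<mu> * (h i j k \<mu> - l i j k \<mu>))"
      if ij: "i \<in> tasks S" "j \<in> jobs S i" for i j k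
    proof (rule integral_unique)
      have "((\<lambda>t. \<Sum>\<mu><?N. c i j \<mu> * indicat_real (J i j k \<mu>) t) has_integral
          (\<Sum>\<mu><?N. c i j \<mu> * (h i j k \<mu> - l i j k \<mu>))) {0..?L}"
        unfolding J_def
      proof (intro has_integral_sum has_integral_mult_right has_integral_indicator_ivl finite_lessThan)
        fix \<mu> assume "\<mu> \<in> {..<?N}"
        then show "0 \<le> l i j k \<mu>" "l i j k \<mu> \<le> h i j k \<mu>" "h i j k \<mu> \<le> ?L"
          using lh[OF ij, of \<mu> k] tau_nonneg[OF S, of \<mu>] tau_le_hyperperiod[of "\<mu> + 1" S] by auto
      qed
      then show "((\<lambda>t. stage_cost S (a' i j k t) (s' i j k t)) has_integral
          (\<Sum>\<mu><?N. c i j \<mu> * (h i j k \<mu> - l i j k \<mu>))) {0..?L}"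
      proof (rule has_integral_spike[of "{?L}", rotated 2])
        fix t assume "t \<in> {0..?L} - {?L}"
        then obtain \<mu> where \<mu>: "\<mu> < ?N" "t \<in> {?\<tau> \<mu>..<?\<tau> (\<mu> + 1)}"
          using cells[of t] by auto
        show "stage_cost S (a' i j k t) (s' i j k t) = (\<Sum>\<mu><?N. c i j \<mu> * indicat_real (J i j k \<mu>) t)"
          using sum_cell_indicator[OF \<mu> Jsub[OF ij]] a_cell[OF ij \<mu>] s_cell[OF \<mu>]
          by (simp add: stage_cost_def c_def)
      qed simp
    qed
    have stage_sum: "(\<Sum>k\<in>procs S. integral {0..?L} (\<lambda>t. stage_cost S (a' i j k t) (s' i j k t)))
        = (\<Sum>\<mu><?N. \<Delta> \<mu> * stage_cost S (a i j \<mu>) (s i j \<mu>))"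
      if ij: "i \<in> tasks S" "j \<in> jobs S i" for i j
    proof -
      have "(\<Sum>k\<in>procs S. integral {0..?L} (\<lambda>t. stage_cost S (a' i j k t) (s' i j k t)))
          = (\<Sum>\<mu><?N. \<Sum>k\<in>procs S. c i j \<mu> * (h i j k \<mu> - l i j k \<mu>))"
        unfolding stage_integral[OF ij] by (rule sum.swap)
      also have "\<dots> = (\<Sum>\<mu><?N. \<Delta> \<mu> * stage_cost S (a i j \<mu>) (s i j \<mu>))"
        using Jlen[OF ij]
        by (intro sum.cong refl) (simp add: stage_cost_def c_def flip: sum_distrib_left)
      finally show ?thesis .
    qed
    have "energy_C S s' a'
        = (\<Sum>i\<in>tasks S. \<Sum>j\<in>jobs S i. \<Sum>\<mu><?N. \<Delta> \<mu> * stage_cost S (a i j \<mu>) (s i j \<mu>))"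
      unfolding energy_C_def by (rule sum.cong[OF refl], rule sum.cong[OF refl], rule stage_sum)
    also have "\<dots> = (\<Sum>i\<in>tasks S. \<Sum>\<mu><?N. \<Sum>j\<in>jobs S i. \<Delta> \<mu> * stage_cost S (a i j \<mu>) (s i j \<mu>))"
      by (intro sum.cong refl sum.swap)
    also have "\<dots> = cost_P S s a"
      unfolding cost_P_def \<Delta>_def by (rule sum.swap)
    finally show ?thesis .
  qed
  ultimately show ?thesis by blast
qed

theorem theorem2:
  fixes S :: rt_system
  assumes "rt_setting S"
  shows "((\<exists>x s a. feasible_C S x s a) \<longrightarrow> (\<exists>x s a. optimal_P S x s a)) \<and>
         (\<forall>x s a. feasible_P S x s a \<longrightarrow>
            (\<exists>x' s' a'. feasible_C S x' s' a' \<and> energy_C S s' a' = cost_P S s a))"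
proof (intro conjI impI allI)
  show "\<exists>x s a. optimal_P S x s a" if "\<exists>x s a. feasible_C S x s a"
  proof -
    from that obtain x s a where "feasible_C S x s a" by blast
    from feasible_C_imp_feasible_P[OF assms this] obtain x' s' a' where "feasible_P S x' s' a'"
      by blast
    then show ?thesis by (rule optimal_P_exists[OF assms])
  qed
  show "\<exists>x' s' a'. feasible_C S x' s' a' \<and> energy_C S s' a' = cost_P S s a"
    if "feasible_P S x s a" for x s a
    using assms that by (rule schedule_from_feasible_P)
qed

end
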